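(* If $D$ is an (oriented) diagram of a generalized link $L$ with no nugatory crossings, then $$tc(D) \geq 2\,(S(D) - \mathrm{ind}(D) - 1),$$ where $tc(D)$ is the total crossing number of $D$, $S(D)$ is the number of Seifert circles of $D$, and $\mathrm{ind}(D)$ is the index of the Seifert graph of $D$.
   Context: A (generalized, oriented) diagram $D$ is a generic immersion in the plane $\mathbb{R}^2$ of finitely many oriented circles, whose only multiple points are finitely many transverse double points (crossings), each crossing being labelled by a crossing type from some fixed set of types (for instance: real, i.e. classical positive or negative; virtual; flat; singular; or any other type). A diagram of a generalized link is such a diagram. $tc(D)$ is the total number of crossings of $D$, of all types. The Seifert circles of $D$ are the disjoint simple closed curves obtained by smoothing every crossing, of whatever type, in the way consistent with the orientation; $S(D)$ is their number. A crossing of $D$ is nugatory if smoothing $D$ at that single crossing (consistently with orientation) yields a diagram with more connected components than $D$. The Seifert graph $\Gamma(D)$ is the graph (multiple edges allowed) with one vertex for each Seifert circle and one edge for each crossing; the edge of a crossing joins the vertices corresponding to the Seifert circles that contain the two arcs produced by smoothing that crossing. For a graph $G$: an edge $e$ is singular if it is the only edge joining its two end points. For a vertex $v$, $\mathrm{star}(v)$ is the smallest subgraph of $G$ containing all edges incident with $v$. For a subgraph $X$, $G/X$ is the graph obtained from $G$ by identifying all points of $X$ to one point. A set $F=\{e_1,\dots,e_k\}$ of edges of $G$ is independent (defined recursively on $k$) if it is empty, or if: (1) every $e_j$ is singular; (2) no two of the $e_j$ are adjacent; (3) there are an edge $e_i\in F$ and an end point $v$ of $e_i$ such that $F\setminus\{e_i\}$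 is an independent set of $k-1$ edges in $G/\mathrm{star}(v)$. $\mathrm{ind}(G)$ is the maximal number of edges in an independent set of edges of $G$, and $\mathrm{ind}(D)=\mathrm{ind}(\Gamma(D))$.
   Formalization: The diagram is additionally assumed to be connected as a subset of the plane, since the inequality fails for disconnected diagrams such as two disjoint circles without crossings (tc = 0, S = 2, ind = 0). *)

theory Defs
  imports "HOL-Analysis.Analysis"
begin

section \<open>Multigraphs, independent edge sets and the index\<close>

record ('v, 'e) mgraph =
  verts :: "'v set"
  edges :: "'e set"
  ends :: "'e \<Rightarrow> 'v set"

definition singular :: "('v, 'e) mgraph \<Rightarrow> 'e \<Rightarrow> bool" where
  "singular G e \<longleftrightarrow> e \<in> edges G \<and> (\<forall>f \<in> edges G. ends G f = ends G e \<longrightarrow> f = e)"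

definition adjacent :: "('v, 'e) mgraph \<Rightarrow> 'e \<Rightarrow> 'e \<Rightarrow> bool" where
  "adjacent G e f \<longleftrightarrow> e \<noteq> f \<and> ends G e \<inter> ends G f \<noteq> {}"

definition star :: "('v, 'e) mgraph \<Rightarrow> 'v \<Rightarrow> ('v, 'e) mgraph" where
  "star G v =
    (let E = {e \<in> edges G. v \<in> ends G e}
     in \<lparr>verts = (\<Union>e\<in>E. ends G e), edges = E, ends = ends G\<rparr>)"

text \<open>
  The quotient of \<open>G\<close> by a subgraph \<open>X\<close>. All points of \<open>X\<close>, those on its edges included,
  become a single vertex, for which a vertex \<open>x\<close> of \<open>X\<close> serves as the name. The edges of \<open>X\<close>
  thereby disappear, while any other edge between vertices of \<open>X\<close> becomes a loop.
\<close>
definition quotient_by ::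
    "('v, 'e) mgraph \<Rightarrow> ('v, 'e) mgraph \<Rightarrow> 'v \<Rightarrow> ('v, 'e) mgraph" where
  "quotient_by G X x =
    (let q = (\<lambda>u. if u \<in> verts X then x else u)
     in \<lparr>verts = q ` verts G, edges = edges G - edges X, ends = (\<lambda>e. q ` ends G e)\<rparr>)"

inductive indep_edges :: "('v, 'e) mgraph \<Rightarrow> 'e set \<Rightarrow> bool" where
  empty: "indep_edges G {}"
| step:
    "\<lbrakk>\<forall>e\<in>F. singular G e;
      \<forall>e\<in>F. \<forall>f\<in>F. \<not> adjacent G e f;
      e \<in> F; v \<in> ends G e;
      indep_edges (quotient_by G (star G v) v) (F - {e})\<rbrakk>
     \<Longrightarrow> indep_edges G F"

definition graph_index :: "('v, 'e) mgraph \<Rightarrow> nat" where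
  "graph_index G = Max {card F |F. indep_edges G F}"


section \<open>Diagrams\<close>

text \<open>
  The \<open>i\<close>-th circle (\<open>i < ncircles D\<close>) is \<open>\<real>/\<int>\<close>, oriented by increasing parameter, and
  \<open>curve D i\<close> is the immersion of this circle, written as a 1-periodic map. Crossings are
  points of the plane; \<open>ctype D\<close> only matters on them, and \<open>'t\<close> is an arbitrary set of types.
\<close>
record 't diagram =
  ncircles :: nat
  curve :: "nat \<Rightarrow> real \<Rightarrow> real ^ 2"
  ctype :: "real ^ 2 \<Rightarrow> 't"

definition dimage :: "('t, 'm) diagram_scheme \<Rightarrow> (real ^ 2) set" where
  "dimage D = (\<Union>i<ncircles D. range (curve D i))"

text \<open>The points of the disjoint union of the circles that are mapped to \<open>z\<close>.\<close>
definition passes :: "('t, 'm) diagram_scheme \<Rightarrow> real ^ 2 \<Rightarrow> (nat \<times> real) set" where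
  "passes D z = {(i, t). i < ncircles D \<and> 0 \<le> t \<and> t < 1 \<and> curve D i t = z}"

definition crossings :: "('t, 'm) diagram_scheme \<Rightarrow> (real ^ 2) set" where
  "crossings D = {z. \<exists>p \<in> passes D z. \<exists>q \<in> passes D z. p \<noteq> q}"

abbreviation velocity :: "('t, 'm) diagram_scheme \<Rightarrow> nat \<times> real \<Rightarrow> real ^ 2" where
  "velocity D p \<equiv> vector_derivative (curve D (fst p)) (at (snd p))"

definition generic_immersion :: "('t, 'm) diagram_scheme \<Rightarrow> bool" where
  "generic_immersion D \<longleftrightarrow>
    (\<forall>i<ncircles D.
       (\<forall>t. curve D i (t + 1) = curve D i t) \<and>
       curve D i C1_differentiable_on UNIV \<and>
       (\<forall>t. vector_derivative (curve D i) (at t) \<noteq> 0)) \<and>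
    finite (crossings D) \<and>
    (\<forall>c \<in> crossings D. card (passes D c) = 2) \<and>
    (\<forall>c \<in> crossings D. \<forall>p \<in> passes D c. \<forall>q \<in> passes D c.
       p \<noteq> q \<longrightarrow> span {velocity D p, velocity D q} = UNIV)"

definition tc :: "('t, 'm) diagram_scheme \<Rightarrow> nat" where
  "tc D = card (crossings D)"


section \<open>Smoothing\<close>

text \<open>
  To smooth a crossing, the part of the diagram inside a small round disc around the crossing
  is replaced by two disjoint chords of the disc, each leading from the point where one strand
  enters the disc to the point where the other strand leaves it. The following two functions
  give the points where the strand through \<open>curve D i s\<close> enters and leaves the disc of
  radius \<open>r\<close> around \<open>curve D i s\<close>.
\<close>
definition entry_time :: "('t, 'm) diagram_scheme \<Rightarrow> real \<Rightarrow> nat \<times> real \<Rightarrow> real" where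
  "entry_time D r = (\<lambda>(i, s). Sup {t. t < s \<and> curve D i t \<notin> ball (curve D i s) r})"

definition exit_time :: "('t, 'm) diagram_scheme \<Rightarrow> real \<Rightarrow> nat \<times> real \<Rightarrow> real" where
  "exit_time D r = (\<lambda>(i, s). Inf {t. s < t \<and> curve D i t \<notin> ball (curve D i s) r})"

definition strand :: "('t, 'm) diagram_scheme \<Rightarrow> real \<Rightarrow> nat \<times> real \<Rightarrow> (real ^ 2) set" where
  "strand D r p = curve D (fst p) ` {entry_time D r p..exit_time D r p}"

definition chord ::
    "('t, 'm) diagram_scheme \<Rightarrow> real \<Rightarrow> nat \<times> real \<Rightarrow> nat \<times> real \<Rightarrow> (real ^ 2) set" where
  "chord D r p q =
     closed_segment (curve D (fst p) (entry_time D r p)) (curve D (fst q) (exit_time D r q))"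

text \<open>
  The radius \<open>r\<close> is small enough: the discs around the crossings are disjoint, the diagram
  meets each of them precisely in the two strands that cross at its centre, and the two new
  arcs in each of them are disjoint.
\<close>
definition smoothing_radius :: "('t, 'm) diagram_scheme \<Rightarrow> real \<Rightarrow> bool" where
  "smoothing_radius D r \<longleftrightarrow>
    0 < r \<and>
    (\<forall>c \<in> crossings D. \<forall>c' \<in> crossings D. c \<noteq> c' \<longrightarrow> cball c r \<inter> cball c' r = {}) \<and>
    (\<forall>i<ncircles D. \<forall>c \<in> crossings D. \<not> range (curve D i) \<subseteq> ball c r) \<and>
    (\<forall>c \<in> crossings D. dimage D \<inter> cball c r = (\<Union>p \<in> passes D c. strand D r p)) \<and>
    (\<forall>c \<in> crossings D. \<forall>p \<in> passes D c. \<forall>q \<in> passes D c.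
       p \<noteq> q \<longrightarrow> chord D r p q \<inter> chord D r q p = {})"

definition radius :: "('t, 'm) diagram_scheme \<Rightarrow> real" where
  "radius D = (SOME r. smoothing_radius D r)"

definition new_arcs :: "('t, 'm) diagram_scheme \<Rightarrow> real ^ 2 \<Rightarrow> (real ^ 2) set set" where
  "new_arcs D c = {chord D (radius D) p q |p q. p \<in> passes D c \<and> q \<in> passes D c \<and> p \<noteq> q}"

text \<open>The diagram obtained by smoothing the crossings in \<open>X\<close>, as a subset of the plane.\<close>
definition smoothing :: "('t, 'm) diagram_scheme \<Rightarrow> (real ^ 2) set \<Rightarrow> (real ^ 2) set" where
  "smoothing D X = (dimage D - (\<Union>c\<in>X. ball c (radius D))) \<union> (\<Union>c\<in>X. \<Union>(new_arcs D c))"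

definition nugatory :: "('t, 'm) diagram_scheme \<Rightarrow> real ^ 2 \<Rightarrow> bool" where
  "nugatory D c \<longleftrightarrow>
    c \<in> crossings D \<and> card (components (smoothing D {c})) > card (components (dimage D))"


section \<open>Seifert circles and the Seifert graph\<close>

text \<open>
  Smoothing all crossings leaves disjoint simple closed curves; these are the connected
  components of the resulting subset of the plane.
\<close>
definition Seifert_circles :: "('t, 'm) diagram_scheme \<Rightarrow> (real ^ 2) set set" where
  "Seifert_circles D = components (smoothing D (crossings D))"

definition Seifert_number :: "('t, 'm) diagram_scheme \<Rightarrow> nat" where
  "Seifert_number D = card (Seifert_circles D)"

definition Seifert_graph ::
    "('t, 'm) diagram_scheme \<Rightarrow> ((real ^ 2) set, real ^ 2) mgraph" where
  "Seifert_graph D =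
    \<lparr>verts = Seifert_circles D,
     edges = crossings D,
     ends = (\<lambda>c. {C \<in> Seifert_circles D. \<exists>a \<in> new_arcs D c. a \<subseteq> C})\<rparr>"

definition diagram_index :: "('t, 'm) diagram_scheme \<Rightarrow> nat" where
  "diagram_index D = graph_index (Seifert_graph D)"


section \<open>Every generic immersion has a smoothing radius\<close>

text \<open>
  All small radii qualify, so that \<^const>\<open>radius\<close> is never an unspecified value for the
  diagrams of interest.
\<close>

lemma norm_increasing_right:
  fixes f g :: "real \<Rightarrow> real ^ 2"
  assumes f: "\<And>t. (f has_vector_derivative g t) (at t)"
    and g: "continuous_on UNIV g" and v: "g s \<noteq> 0"
  obtains d where "d > 0"
    "\<And>t u. s \<le> t \<Longrightarrow> t < u \<Longrightarrow> u \<le> s + d \<Longrightarrow> norm (f t - f s) < norm (f u - f s)"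
proof -
  let ?e = "norm (g s) / 4"
  have e: "?e > 0" using v by simp
  have "isCont g s" using g by (simp add: continuous_on_eq_continuous_at)
  then obtain d0 where d0: "d0 > 0" "\<And>t. dist t s < d0 \<Longrightarrow> dist (g t) (g s) < ?e"
    using e unfolding continuous_at_eps_delta by (metis)
  define d where "d = d0 / 2"
  have d: "d > 0" "\<And>t. s \<le> t \<Longrightarrow> t \<le> s + d \<Longrightarrow> norm (g t - g s) \<le> ?e"
    using d0(1) d0(2) by (force simp: d_def dist_norm intro: less_imp_le)+
  have lin: "norm (f t - f s - (t - s) *\<^sub>R g s) \<le> ?e * (t - s)" if "s \<le> t" "t \<le> s + d" for t
  proof -
    let ?h = "\<lambda>x. f x - x *\<^sub>R g s"
    have "norm (?h t - ?h s) \<le> ?e * norm (t - s)"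
    proof (rule differentiable_bound[of "{s..t}"])
      fix x assume x: "x \<in> {s..t}"
      show "(?h has_derivative (\<lambda>y. y *\<^sub>R (g x - g s))) (at x within {s..t})"
        using f[of x, unfolded has_vector_derivative_def]
        by (auto intro!: derivative_eq_intros intro: has_derivative_at_withinI
            simp: scaleR_diff_right)
      have "norm (g x - g s) \<le> ?e" using x that d(2) by auto
      then show "onorm (\<lambda>y::real. y *\<^sub>R (g x - g s)) \<le> ?e"
        using mult_right_mono[of "norm (g x - g s)" ?e] by (intro onorm_le) (simp add: mult.commute)
    qed (use that in auto)
    then show ?thesis using that by (simp add: algebra_simps)
  qed
  have pos: "(f t - f s) \<bullet> g t > 0" if t: "s < t" "t \<le> s + d" for t
  proof -
    let ?a = "f t - f s - (t - s) *\<^sub>R g s" and ?b = "g t - g s" and ?N = "norm (g s)"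
    have a: "norm ?a \<le> ?e * (t - s)" using lin t by auto
    have b: "norm ?b \<le> ?e" using d t by auto
    have "(f t - f s) \<bullet> g t = (?a + (t - s) *\<^sub>R g s) \<bullet> (?b + g s)" by simp
    also have "\<dots> = ?a \<bullet> ?b + ?a \<bullet> g s + (t - s) * (g s \<bullet> ?b) + (t - s) * (g s \<bullet> g s)"
      by (simp only: inner_add_left inner_add_right inner_scaleR_left)
    finally have eq: "(f t - f s) \<bullet> g t = ?a \<bullet> ?b + ?a \<bullet> g s + (t - s) * (g s \<bullet> ?b) + (t - s) * (g s \<bullet> g s)" .
    have 1: "\<bar>?a \<bullet> ?b\<bar> \<le> (?e * (t - s)) * ?e"
      by (rule order_trans[OF Cauchy_Schwarz_ineq2]) (use a b e t in \<open>intro mult_mono; auto\<close>)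
    have 2: "\<bar>?a \<bullet> g s\<bar> \<le> (?e * (t - s)) * ?N"
      by (rule order_trans[OF Cauchy_Schwarz_ineq2]) (use a in \<open>intro mult_right_mono; auto\<close>)
    have "\<bar>g s \<bullet> ?b\<bar> \<le> ?N * ?e"
      by (rule order_trans[OF Cauchy_Schwarz_ineq2]) (use b in \<open>intro mult_left_mono; auto\<close>)
    then have 3: "(t - s) * \<bar>g s \<bullet> ?b\<bar> \<le> (t - s) * (?N * ?e)" using t by (intro mult_left_mono) auto
    have 6: "\<bar>(t - s) * (g s \<bullet> ?b)\<bar> \<le> (t - s) * (?N * ?e)" using 3 t by (simp add: abs_mult)
    have 4: "(t - s) * (g s \<bullet> g s) = (t - s) * (?N * ?N)"
      by (simp add: power2_norm_eq_inner[symmetric] power2_eq_square)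
    have 5: "(t - s) * (?N * ?N) > 0" using t v by simp
    have "?e * (t - s) * ?e = (t - s) * (?N * ?N) / 16" "?e * (t - s) * ?N = (t - s) * (?N * ?N) / 4"
      "(t - s) * (?N * ?e) = (t - s) * (?N * ?N) / 4" by (auto simp: field_simps)
    then show ?thesis using eq 1 2 6 4 5 by linarith
  qed
  have "norm (f t - f s) < norm (f u - f s)" if tu: "s \<le> t" "t < u" "u \<le> s + d" for t u
  proof -
    let ?h = "\<lambda>x. (f x - f s) \<bullet> (f x - f s)"
    have der: "(?h has_real_derivative 2 * ((f x - f s) \<bullet> g x)) (at x)" for x
    proof -
      have D: "((\<lambda>x. f x - f s) has_derivative (\<lambda>y. y *\<^sub>R g x)) (at x)"
        using has_derivative_diff[OF f[of x, unfolded has_vector_derivative_def] has_derivative_const[of "f s"]]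
        by simp
      have "(?h has_derivative (\<lambda>y. (f x - f s) \<bullet> (y *\<^sub>R g x) + (y *\<^sub>R g x) \<bullet> (f x - f s))) (at x)"
        by (rule has_derivative_inner[OF D D])
      moreover have "(\<lambda>y. (f x - f s) \<bullet> (y *\<^sub>R g x) + (y *\<^sub>R g x) \<bullet> (f x - f s)) =
          (*) (2 * ((f x - f s) \<bullet> g x))"
        by (auto simp: fun_eq_iff inner_commute)
      ultimately show ?thesis unfolding has_field_derivative_def by simp
    qed
    have "?h t < ?h u"
    proof (rule DERIV_pos_imp_increasing_open[OF tu(2)])
      fix x assume x: "t < x" "x < u"
      have "2 * ((f x - f s) \<bullet> g x) > 0" using pos[of x] x tu by auto
      then show "\<exists>y. (?h has_real_derivative y) (at x) \<and> y > 0" using der by blast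
    next
      show "continuous_on {t..u} ?h"
        by (rule DERIV_continuous_on, rule has_field_derivative_at_within, rule der)
    qed
    then show ?thesis by (simp add: norm_lt)
  qed
  then show ?thesis using that d(1) by blast
qed

lemma exit_right:
  fixes f g :: "real \<Rightarrow> real ^ 2"
  assumes f: "\<And>t. (f has_vector_derivative g t) (at t)"
    and g: "continuous_on UNIV g" and v: "g s \<noteq> 0"
  defines "T \<equiv> \<lambda>r. Inf {t. s < t \<and> f t \<notin> ball (f s) r}"
  obtains d where "d > 0"
    "\<forall>\<^sub>F r in at_right 0. s < T r \<and> T r \<le> s + d \<and> norm (f (T r) - f s) = r
       \<and> (\<forall>t\<in>{s..s+d}. norm (f t - f s) \<le> r \<longrightarrow> t \<le> T r)
       \<and> (\<forall>t\<in>{s..T r}. norm (f t - f s) \<le> r)"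
    "((\<lambda>r. sgn (f (T r) - f s)) \<longlongrightarrow> sgn (g s)) (at_right 0)"
proof -
  obtain d where d: "d > 0" and
    mono: "\<And>t u. s \<le> t \<Longrightarrow> t < u \<Longrightarrow> u \<le> s + d \<Longrightarrow> norm (f t - f s) < norm (f u - f s)"
    using norm_increasing_right[OF f g v] by blast
  have cont: "continuous_on A f" for A
    using f by (meson continuous_at_imp_continuous_on has_vector_derivative_continuous)
  have cn: "continuous_on A (\<lambda>t. norm (f t - f s))" for A
    by (intro continuous_intros cont)
  have main: "s < T r \<and> T r \<le> s + e \<and> norm (f (T r) - f s) = r
       \<and> (\<forall>t\<in>{s..s+d}. norm (f t - f s) \<le> r \<longrightarrow> t \<le> T r)
       \<and> (\<forall>t\<in>{s..T r}. norm (f t - f s) \<le> r)"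
    if e: "0 < e" "e \<le> d" and r: "0 < r" "r \<le> norm (f (s + e) - f s)" for e r
  proof -
    obtain x where x: "s \<le> x" "x \<le> s + e" "norm (f x - f s) = r"
      using IVT'[of "\<lambda>t. norm (f t - f s)" s r "s + e"] r e cn by auto
    have sx: "s < x" using x r by (cases "x = s") auto
    have lo: "norm (f t - f s) < r" if "s \<le> t" "t < x" for t
      using mono[of t x] that x e by auto
    have Tx: "T r = x" unfolding T_def
    proof (rule cInf_eq_minimum)
      show "x \<in> {t. s < t \<and> f t \<notin> ball (f s) r}"
        using sx x by (simp add: dist_norm norm_minus_commute)
      fix t assume "t \<in> {t. s < t \<and> f t \<notin> ball (f s) r}"
      then have "s < t" "r \<le> norm (f t - f s)" by (auto simp: dist_norm norm_minus_commute)
      then show "x \<le> t" using lo[of t] by linarith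
    qed
    have hi: "t \<le> x" if "s \<le> t" "t \<le> s + d" "norm (f t - f s) \<le> r" for t
    proof (rule ccontr)
      assume "\<not> t \<le> x"
      then show False using mono[of x t] that x by linarith
    qed
    have le: "norm (f t - f s) \<le> r" if "s \<le> t" "t \<le> x" for t
      using lo[of t] x that by (cases "t = x") auto
    show ?thesis unfolding Tx using x(2,3) sx hi le by (meson atLeastAtMost_iff)
  qed
  have ev: "\<forall>\<^sub>F r in at_right 0. 0 < r \<and> r \<le> norm (f (s + e) - f s)" if "0 < e" "e \<le> d" for e
  proof -
    have "norm (f (s + e) - f s) > 0" using mono[of s "s + e"] that by auto
    then show ?thesis unfolding eventually_at_right_field by (intro exI[of _ "norm (f (s + e) - f s)"]) auto
  qed
  have lim: "filterlim T (at_right s) (at_right 0)"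
    unfolding filterlim_at
  proof (intro conjI)
    show "\<forall>\<^sub>F r in at_right 0. T r \<in> {s<..} \<and> T r \<noteq> s"
      using ev[OF d order_refl] 
    proof eventually_elim
      case (elim r)
      then have "s < T r" using main[OF d order_refl] by blast
      then show ?case by simp
    qed
    show "(T \<longlongrightarrow> s) (at_right 0)"
    proof (rule tendstoI)
      fix e :: real assume "e > 0"
      define e' where "e' = min (e / 2) d"
      have e': "0 < e'" "e' \<le> d" "e' < e" using \<open>e > 0\<close> d by (auto simp: e'_def min_def)
      show "\<forall>\<^sub>F r in at_right 0. dist (T r) s < e"
        using ev[OF e'(1,2)]
      proof eventually_elim
        case (elim r)
        then have "s < T r \<and> T r \<le> s + e'" using main[OF e'(1,2)] by blast
        then show ?case using e' by (auto simp: dist_real_def)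
      qed
    qed
  qed
  have "((\<lambda>t. (f t - f s) /\<^sub>R (t - s)) \<longlongrightarrow> g s) (at_right s)"
  proof -
    have "((\<lambda>t. (f t - f s - (t - s) *\<^sub>R g s) /\<^sub>R norm (t - s)) \<longlongrightarrow> 0) (at_right s)"
      using has_vector_derivative_at_within[OF f[of s], of "{s<..}"]
      unfolding has_vector_derivative_def has_derivative_at_within by blast
    then have "((\<lambda>t. (f t - f s - (t - s) *\<^sub>R g s) /\<^sub>R norm (t - s) + g s) \<longlongrightarrow> 0 + g s) (at_right s)"
      by (intro tendsto_add tendsto_const)
    moreover have "\<forall>\<^sub>F t in at_right s. (f t - f s - (t - s) *\<^sub>R g s) /\<^sub>R norm (t - s) + g s = (f t - f s) /\<^sub>R (t - s)"
      using eventually_at_right_less by (rule eventually_mono) (simp add: scaleR_diff_right)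
    ultimately show ?thesis by (simp add: Lim_transform_eventually)
  qed
  then have "((\<lambda>r. (f (T r) - f s) /\<^sub>R (T r - s)) \<longlongrightarrow> g s) (at_right 0)"
    using lim by (rule filterlim_compose)
  then have "((\<lambda>r. sgn ((f (T r) - f s) /\<^sub>R (T r - s))) \<longlongrightarrow> sgn (g s)) (at_right 0)"
    using v by (rule tendsto_sgn)
  moreover have "\<forall>\<^sub>F r in at_right 0. sgn ((f (T r) - f s) /\<^sub>R (T r - s)) = sgn (f (T r) - f s)"
    using ev[OF d order_refl]
  proof eventually_elim
    case (elim r)
    then have "s < T r" using main[OF d order_refl] by blast
    then show ?case by (simp add: sgn_scaleR)
  qed
  ultimately have "((\<lambda>r. sgn (f (T r) - f s)) \<longlongrightarrow> sgn (g s)) (at_right 0)"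
    by (rule Lim_transform_eventually)
  moreover have "\<forall>\<^sub>F r in at_right 0. s < T r \<and> T r \<le> s + d \<and> norm (f (T r) - f s) = r
       \<and> (\<forall>t\<in>{s..s+d}. norm (f t - f s) \<le> r \<longrightarrow> t \<le> T r)
       \<and> (\<forall>t\<in>{s..T r}. norm (f t - f s) \<le> r)"
    using ev[OF d order_refl] by eventually_elim (use main[OF d order_refl] in blast)
  ultimately show ?thesis using that d by blast
qed

lemma entry_left:
  fixes f g :: "real \<Rightarrow> real ^ 2"
  assumes f: "\<And>t. (f has_vector_derivative g t) (at t)"
    and g: "continuous_on UNIV g" and v: "g s \<noteq> 0"
  defines "T \<equiv> \<lambda>r. Sup {t. t < s \<and> f t \<notin> ball (f s) r}"
  obtains d where "d > 0"
    "\<forall>\<^sub>F r in at_right 0. T r < s \<and> s - d \<le> T r \<and> norm (f (T r) - f s) = r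
       \<and> (\<forall>t\<in>{s-d..s}. norm (f t - f s) \<le> r \<longrightarrow> T r \<le> t)
       \<and> (\<forall>t\<in>{T r..s}. norm (f t - f s) \<le> r)"
    "((\<lambda>r. sgn (f (T r) - f s)) \<longlongrightarrow> - sgn (g s)) (at_right 0)"
proof -
  let ?f = "\<lambda>t. f (- t)" and ?g = "\<lambda>t. - g (- t)"
  have f': "(?f has_vector_derivative ?g t) (at t)" for t
  proof -
    have "((f \<circ> uminus) has_vector_derivative (- 1) *\<^sub>R g (- t)) (at t)"
      by (rule vector_diff_chain_at) (auto intro!: derivative_eq_intros f)
    then show ?thesis by (simp add: o_def)
  qed
  have g': "continuous_on UNIV ?g"
    by (intro continuous_intros continuous_on_compose2[OF g]) auto
  have T: "Inf {t. - s < t \<and> f (- t) \<notin> ball (f s) r} = - T r" for r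
  proof -
    have "uminus ` {t. - s < t \<and> f (- t) \<notin> ball (f s) r} = {t. t < s \<and> f t \<notin> ball (f s) r}"
      by (auto simp: image_iff intro!: exI[of _ "- _"])
    then show ?thesis by (simp add: Inf_real_def T_def)
  qed
  have v': "?g (- s) \<noteq> 0" using v by simp
  obtain d where d: "d > 0"
    "\<forall>\<^sub>F r in at_right 0. - s < - T r \<and> - T r \<le> - s + d \<and> norm (f (T r) - f s) = r
       \<and> (\<forall>t\<in>{-s..-s+d}. norm (f (- t) - f s) \<le> r \<longrightarrow> t \<le> - T r)
       \<and> (\<forall>t\<in>{-s..- T r}. norm (f (- t) - f s) \<le> r)"
    "((\<lambda>r. sgn (f (T r) - f s)) \<longlongrightarrow> sgn (- g s)) (at_right 0)"
    by (rule exit_right[of ?f ?g, OF f' g' v', unfolded minus_minus T])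
  show ?thesis
  proof (rule that[OF d(1)])
    show "((\<lambda>r. sgn (f (T r) - f s)) \<longlongrightarrow> - sgn (g s)) (at_right 0)"
      using d(3) by (simp add: sgn_minus)
    show "\<forall>\<^sub>F r in at_right 0. T r < s \<and> s - d \<le> T r \<and> norm (f (T r) - f s) = r
       \<and> (\<forall>t\<in>{s-d..s}. norm (f t - f s) \<le> r \<longrightarrow> T r \<le> t)
       \<and> (\<forall>t\<in>{T r..s}. norm (f t - f s) \<le> r)"
      using d(2)
    proof eventually_elim
      case (elim r)
      have "T r \<le> t" if "t \<in> {s-d..s}" "norm (f t - f s) \<le> r" for t
      proof -
        have "- t \<in> {-s..-s+d}" using that by simp
        moreover have "norm (f (- (- t)) - f s) \<le> r" using that by simp
        ultimately have "- t \<le> - T r" using elim by blast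
        then show ?thesis by simp
      qed
      moreover have "norm (f t - f s) \<le> r" if "t \<in> {T r..s}" for t
      proof -
        have "- t \<in> {-s..- T r}" using that by simp
        then have "norm (f (- (- t)) - f s) \<le> r" using elim by blast
        then show ?thesis by simp
      qed
      moreover have "T r < s" "s - d \<le> T r" "norm (f (T r) - f s) = r" using elim by auto
      ultimately show ?case by blast
    qed
  qed
qed

lemma generic_immersionD:
  assumes "generic_immersion D"
  shows "i < ncircles D \<Longrightarrow> curve D i (t + 1) = curve D i t"
    and "i < ncircles D \<Longrightarrow>
      (curve D i has_vector_derivative vector_derivative (curve D i) (at t)) (at t)"
    and "i < ncircles D \<Longrightarrow> continuous_on UNIV (\<lambda>t. vector_derivative (curve D i) (at t))"
    and "i < ncircles D \<Longrightarrow> vector_derivative (curve D i) (at t) \<noteq> 0"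
    and "finite (crossings D)"
    and "c \<in> crossings D \<Longrightarrow> card (passes D c) = 2"
    and "c \<in> crossings D \<Longrightarrow> p \<in> passes D c \<Longrightarrow> q \<in> passes D c \<Longrightarrow> p \<noteq> q \<Longrightarrow>
      span {velocity D p, velocity D q} = UNIV"
  using assms unfolding generic_immersion_def C1_differentiable_on_eq
  by (auto simp: vector_derivative_works)

lemma curve_periodic_int:
  assumes "generic_immersion D" "i < ncircles D"
  shows "curve D i (t + of_int k) = curve D i t"
proof (induction k arbitrary: t rule: int_induct[where k = 0])
  case (step1 k)
  then show ?case
    using generic_immersionD(1)[OF assms, of "t + of_int k"] by (simp add: algebra_simps)
next
  case (step2 k)
  then show ?case
    using generic_immersionD(1)[OF assms, of "t + of_int (k - 1)"] by (simp add: algebra_simps)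
qed auto

lemma pass_neighbourhood:
  assumes D: "generic_immersion D" and p: "(i, s) \<in> passes D c"
  obtains d where "d > 0"
    "\<forall>\<^sub>F r in at_right 0. entry_time D r (i, s) < s \<and> s < exit_time D r (i, s)
       \<and> (\<forall>t\<in>{s-d..s+d}. norm (curve D i t - c) \<le> r \<longrightarrow> t \<in> {entry_time D r (i, s)..exit_time D r (i, s)})
       \<and> strand D r (i, s) \<subseteq> cball c r
       \<and> norm (curve D i (entry_time D r (i, s)) - c) = r
       \<and> norm (curve D i (exit_time D r (i, s)) - c) = r"
    "((\<lambda>r. sgn (curve D i (entry_time D r (i, s)) - c)) \<longlongrightarrow> - sgn (velocity D (i, s))) (at_right 0)"
    "((\<lambda>r. sgn (curve D i (exit_time D r (i, s)) - c)) \<longlongrightarrow> sgn (velocity D (i, s))) (at_right 0)"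
proof -
  have i: "i < ncircles D" and c: "curve D i s = c" using p by (auto simp: passes_def)
  note f = generic_immersionD(2,3,4)[OF D i]
  have ex: "exit_time D r (i, s) = Inf {t. s < t \<and> curve D i t \<notin> ball c r}"
    and en: "entry_time D r (i, s) = Sup {t. t < s \<and> curve D i t \<notin> ball c r}" for r
    using c by (auto simp: exit_time_def entry_time_def)
  obtain d where d: "d > 0"
    "\<forall>\<^sub>F r in at_right 0. s < exit_time D r (i, s) \<and> exit_time D r (i, s) \<le> s + d
       \<and> norm (curve D i (exit_time D r (i, s)) - c) = r
       \<and> (\<forall>t\<in>{s..s+d}. norm (curve D i t - c) \<le> r \<longrightarrow> t \<le> exit_time D r (i, s))
       \<and> (\<forall>t\<in>{s..exit_time D r (i, s)}. norm (curve D i t - c) \<le> r)"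
    "((\<lambda>r. sgn (curve D i (exit_time D r (i, s)) - c)) \<longlongrightarrow> sgn (velocity D (i, s))) (at_right 0)"
    unfolding ex fst_conv snd_conv
    by (rule exit_right[of "curve D i" "\<lambda>t. vector_derivative (curve D i) (at t)" s, OF f, unfolded c])
  obtain d' where d': "d' > 0"
    "\<forall>\<^sub>F r in at_right 0. entry_time D r (i, s) < s \<and> s - d' \<le> entry_time D r (i, s)
       \<and> norm (curve D i (entry_time D r (i, s)) - c) = r
       \<and> (\<forall>t\<in>{s-d'..s}. norm (curve D i t - c) \<le> r \<longrightarrow> entry_time D r (i, s) \<le> t)
       \<and> (\<forall>t\<in>{entry_time D r (i, s)..s}. norm (curve D i t - c) \<le> r)"
    "((\<lambda>r. sgn (curve D i (entry_time D r (i, s)) - c)) \<longlongrightarrow> - sgn (velocity D (i, s))) (at_right 0)"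
    unfolding en fst_conv snd_conv
    by (rule entry_left[of "curve D i" "\<lambda>t. vector_derivative (curve D i) (at t)" s, OF f, unfolded c])
  show ?thesis
  proof (rule that[of "min d d'"])
    show "\<forall>\<^sub>F r in at_right 0. entry_time D r (i, s) < s \<and> s < exit_time D r (i, s)
       \<and> (\<forall>t\<in>{s-min d d'..s+min d d'}. norm (curve D i t - c) \<le> r \<longrightarrow> t \<in> {entry_time D r (i, s)..exit_time D r (i, s)})
       \<and> strand D r (i, s) \<subseteq> cball c r
       \<and> norm (curve D i (entry_time D r (i, s)) - c) = r
       \<and> norm (curve D i (exit_time D r (i, s)) - c) = r"
      using d(2) d'(2)
    proof eventually_elim
      case (elim r)
      have in_strand: "t \<in> {entry_time D r (i, s)..exit_time D r (i, s)}"
        if "t \<in> {s-min d d'..s+min d d'}" "norm (curve D i t - c) \<le> r" for t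
      proof (cases "t \<le> s")
        case True
        then have "t \<in> {s-d'..s}" using that(1) unfolding atLeastAtMost_iff by linarith
        then have "entry_time D r (i, s) \<le> t" using elim(2) that(2) by blast
        moreover have "s < exit_time D r (i, s)" using elim(1) by blast
        ultimately show ?thesis using True by simp
      next
        case False
        then have "t \<in> {s..s+d}" using that(1) unfolding atLeastAtMost_iff by linarith
        then have "t \<le> exit_time D r (i, s)" using elim(1) that(2) by blast
        moreover have "entry_time D r (i, s) < s" using elim(2) by blast
        ultimately show ?thesis using False by simp
      qed
      have "norm (curve D i t - c) \<le> r" if "t \<in> {entry_time D r (i, s)..exit_time D r (i, s)}" for t
      proof (cases "t \<le> s")
        case True
        then have "t \<in> {entry_time D r (i, s)..s}" using that by simp
        then show ?thesis using elim(2) by blast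
      next
        case False
        then have "t \<in> {s..exit_time D r (i, s)}" using that by simp
        then show ?thesis using elim(1) by blast
      qed
      then have "strand D r (i, s) \<subseteq> cball c r"
        by (auto simp: strand_def dist_norm norm_minus_commute)
      then show ?case using elim in_strand by blast
    qed
    show "min d d' > 0" using d(1) d'(1) by simp
  qed (rule d(3) d'(3))+
qed

lemma chords_disjoint:
  assumes D: "generic_immersion D" and c: "c \<in> crossings D"
    and p: "p \<in> passes D c" and q: "q \<in> passes D c" and pq: "p \<noteq> q"
  shows "\<forall>\<^sub>F r in at_right 0. chord D r p q \<inter> chord D r q p = {}"
proof -
  obtain i s where i_s: "p = (i, s)" by (cases p)
  obtain j t where jt: "q = (j, t)" by (cases q)
  let ?a = "\<lambda>r. curve D i (entry_time D r p) - c" and ?b = "\<lambda>r. curve D i (exit_time D r p) - c"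
  let ?a' = "\<lambda>r. curve D j (entry_time D r q) - c" and ?b' = "\<lambda>r. curve D j (exit_time D r q) - c"
  let ?v = "velocity D p" and ?w = "velocity D q"
  define u where "u = sgn ?v"
  define w where "w = sgn ?w"
  have lim: "((\<lambda>r. sgn (?a r)) \<longlongrightarrow> - u) (at_right 0)" "((\<lambda>r. sgn (?b r)) \<longlongrightarrow> u) (at_right 0)"
    unfolding i_s u_def by (rule pass_neighbourhood[OF D p[unfolded i_s]], assumption)+
  have lim': "((\<lambda>r. sgn (?a' r)) \<longlongrightarrow> - w) (at_right 0)" "((\<lambda>r. sgn (?b' r)) \<longlongrightarrow> w) (at_right 0)"
    unfolding jt w_def by (rule pass_neighbourhood[OF D q[unfolded jt]], assumption)+
  have ij: "i < ncircles D" "j < ncircles D" using p q by (auto simp: passes_def i_s jt)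
  have nz: "?v \<noteq> 0" "?w \<noteq> 0" using generic_immersionD(4)[OF D] ij by (auto simp: i_s jt)
  have "u \<noteq> w"
  proof
    assume "u = w"
    moreover have "norm ?v *\<^sub>R u = ?v" "norm ?w *\<^sub>R w = ?w"
      using nz by (simp_all add: u_def w_def sgn_div_norm)
    ultimately have "norm ?v *\<^sub>R u = ?v" "norm ?w *\<^sub>R u = ?w" by simp_all
    then have "?v \<in> span {u}" "?w \<in> span {u}" by (metis span_base span_scale singletonI)+
    then have "span {?v, ?w} \<subseteq> span {u}" by (intro span_minimal) auto
    then have "span {u} = (UNIV :: (real^2) set)" using generic_immersionD(7)[OF D c p q pq] by auto
    then have "dim {u} = dim (UNIV :: (real^2) set)" by (metis dim_span)
    then show False using dim_le_card[of "{u}" "{u}"] span_superset[of "{u}"] by (simp add: dim_UNIV)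
  qed
  have nu: "norm u = 1" "norm w = 1" using nz by (auto simp: u_def w_def norm_sgn)
  let ?n = "u - w"
  have uw: "u \<bullet> w < 1"
  proof -
    have "0 < ?n \<bullet> ?n" using \<open>u \<noteq> w\<close> by simp
    then show ?thesis using nu by (simp add: inner_diff_left inner_diff_right inner_commute norm_eq_1)
  qed
  have ev1: "\<forall>\<^sub>F r in at_right 0. sgn (?a r) \<bullet> ?n < 0"
    using order_tendstoD(2)[OF tendsto_inner[OF lim(1) tendsto_const[of ?n]], of 0] uw nu
    by (simp add: inner_diff_right norm_eq_1)
  have ev2: "\<forall>\<^sub>F r in at_right 0. sgn (?b' r) \<bullet> ?n < 0"
    using order_tendstoD(2)[OF tendsto_inner[OF lim'(2) tendsto_const[of ?n]], of 0] uw nu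
    by (simp add: inner_diff_right inner_commute norm_eq_1)
  have ev3: "\<forall>\<^sub>F r in at_right 0. sgn (?a' r) \<bullet> ?n > 0"
    using order_tendstoD(1)[OF tendsto_inner[OF lim'(1) tendsto_const[of ?n]], of 0] uw nu
    by (simp add: inner_diff_right inner_commute norm_eq_1)
  have ev4: "\<forall>\<^sub>F r in at_right 0. sgn (?b r) \<bullet> ?n > 0"
    using order_tendstoD(1)[OF tendsto_inner[OF lim(2) tendsto_const[of ?n]], of 0] uw nu
    by (simp add: inner_diff_right inner_commute norm_eq_1)
  show ?thesis using ev1 ev2 ev3 ev4
  proof eventually_elim
    case (elim r)
    have neg: "x \<bullet> ?n < 0" if "sgn x \<bullet> ?n < 0" for x :: "real^2"
      using that by (cases "x = 0") (auto simp: sgn_div_norm mult_less_0_iff)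
    have pos: "x \<bullet> ?n > 0" if "sgn x \<bullet> ?n > 0" for x :: "real^2"
      using that by (cases "x = 0") (auto simp: sgn_div_norm zero_less_mult_iff)
    have "chord D r p q \<subseteq> {x. ?n \<bullet> x < ?n \<bullet> c}"
      unfolding chord_def using neg[OF elim(1)] neg[OF elim(2)]
      by (intro closed_segment_subset convex_halfspace_lt)
        (auto simp: i_s jt inner_diff_left inner_diff_right inner_commute)
    moreover have "chord D r q p \<subseteq> {x. ?n \<bullet> x > ?n \<bullet> c}"
      unfolding chord_def using pos[OF elim(3)] pos[OF elim(4)]
      by (intro closed_segment_subset convex_halfspace_gt)
        (auto simp: i_s jt inner_diff_left inner_diff_right inner_commute)
    ultimately show ?case by fastforce
  qed
qed

lemma near_crossing:
  assumes D: "generic_immersion D" and i: "i < ncircles D" and d: "\<And>p. p \<in> passes D c \<Longrightarrow> d p > 0"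
  shows "\<forall>\<^sub>F r in at_right 0. \<forall>t. norm (curve D i t - c) \<le> r \<longrightarrow>
     (\<exists>s k. (i, s) \<in> passes D c \<and> t + of_int k \<in> {s - d (i, s)..s + d (i, s)})"
proof -
  define K where "K = {0..1} - (\<Union>s\<in>{s. (i, s) \<in> passes D c}. \<Union>k. {s - d (i, s) - of_int k<..<s + d (i, s) - of_int k})"
  have "compact K" unfolding K_def by (intro compact_diff open_UN) auto
  have cont: "continuous_on A (curve D i)" for A
    using generic_immersionD(2)[OF D i] by (meson continuous_at_imp_continuous_on has_vector_derivative_continuous)
  have nz: "curve D i t \<noteq> c" if "t \<in> K" for t
  proof
    assume t: "curve D i t = c"
    then have "curve D i (t + of_int (- \<lfloor>t\<rfloor>)) = c" using curve_periodic_int[OF D i] by metis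
    then have "curve D i (frac t) = c" by (simp add: frac_def)
    then have "(i, frac t) \<in> passes D c" using i by (simp add: passes_def frac_lt_1)
    moreover from d[OF this] have "t \<in> {frac t - d (i, frac t) - of_int (- \<lfloor>t\<rfloor>)<..<frac t + d (i, frac t) - of_int (- \<lfloor>t\<rfloor>)}"
      by (auto simp: frac_def)
    ultimately show False using that unfolding K_def by blast
  qed
  obtain e where e: "e > 0" "\<And>t. t \<in> K \<Longrightarrow> e \<le> norm (curve D i t - c)"
  proof (cases "K = {}")
    case False
    obtain x where x: "x \<in> K" "\<forall>t\<in>K. norm (curve D i x - c) \<le> norm (curve D i t - c)"
      using continuous_attains_inf[OF \<open>compact K\<close> False, of "\<lambda>t. norm (curve D i t - c)"]
        continuous_on_norm[OF continuous_on_diff[OF cont continuous_on_const]] by blast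
    then show ?thesis using that[of "norm (curve D i x - c)"] nz by auto
  qed (use that[of 1] in auto)
  have "\<forall>\<^sub>F r in at_right 0. r < e"
    using e(1) eventually_at_right_field by auto
  then show ?thesis
  proof eventually_elim
    case (elim r)
    show ?case
    proof (intro allI impI)
      fix t assume t: "norm (curve D i t - c) \<le> r"
      have "curve D i (frac t) = curve D i t"
        using curve_periodic_int[OF D i, of t "- \<lfloor>t\<rfloor>"] by (simp add: frac_def)
      then have "frac t \<notin> K" using e(2)[of "frac t"] t elim by auto
      then obtain s k where sk: "(i, s) \<in> passes D c"
        "frac t \<in> {s - d (i, s) - of_int k<..<s + d (i, s) - of_int k}"
        unfolding K_def by (auto simp: frac_lt_1 less_imp_le)
      then have "t + of_int (k - \<lfloor>t\<rfloor>) \<in> {s - d (i, s)..s + d (i, s)}" by (auto simp: frac_def)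
      then show "\<exists>s k. (i, s) \<in> passes D c \<and> t + of_int k \<in> {s - d (i, s)..s + d (i, s)}"
        using sk by blast
    qed
  qed
qed

lemma disc_meets_strands:
  assumes D: "generic_immersion D" and c: "c \<in> crossings D"
  shows "\<forall>\<^sub>F r in at_right 0. dimage D \<inter> cball c r = (\<Union>p \<in> passes D c. strand D r p)"
proof -
  have fin: "finite (passes D c)"
    using generic_immersionD(6)[OF D c] by (metis card.infinite zero_neq_numeral)
  define P where "P = (\<lambda>p d r. (\<forall>t\<in>{snd p-d..snd p+d}. norm (curve D (fst p) t - c) \<le> r \<longrightarrow>
        t \<in> {entry_time D r p..exit_time D r p}) \<and> strand D r p \<subseteq> cball c r)"
  have "\<exists>d>0. \<forall>\<^sub>F r in at_right 0. P p d r" if pc: "p \<in> passes D c" for p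
  proof -
    obtain i s where p: "p = (i, s)" by (cases p)
    obtain d where "d > 0"
      "\<forall>\<^sub>F r in at_right 0. entry_time D r (i, s) < s \<and> s < exit_time D r (i, s)
       \<and> (\<forall>t\<in>{s-d..s+d}. norm (curve D i t - c) \<le> r \<longrightarrow> t \<in> {entry_time D r (i, s)..exit_time D r (i, s)})
       \<and> strand D r (i, s) \<subseteq> cball c r
       \<and> norm (curve D i (entry_time D r (i, s)) - c) = r
       \<and> norm (curve D i (exit_time D r (i, s)) - c) = r"
      by (rule pass_neighbourhood[OF D pc[unfolded p]])
    then show ?thesis unfolding p P_def by (intro exI[of _ d]) (auto elim: eventually_mono)
  qed
  then obtain d where d: "\<And>p. p \<in> passes D c \<Longrightarrow> d p > 0"
    "\<And>p. p \<in> passes D c \<Longrightarrow> \<forall>\<^sub>F r in at_right 0. P p (d p) r" by metis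
  have 1: "\<forall>\<^sub>F r in at_right 0. \<forall>p\<in>passes D c. P p (d p) r"
    using d(2) fin by (simp add: eventually_ball_finite_distrib)
  have 2: "\<forall>\<^sub>F r in at_right 0. \<forall>i\<in>{..<ncircles D}. \<forall>t. norm (curve D i t - c) \<le> r \<longrightarrow>
     (\<exists>s k. (i, s) \<in> passes D c \<and> t + of_int k \<in> {s - d (i, s)..s + d (i, s)})"
    by (intro eventually_ball_finite ballI near_crossing[OF D]) (use d(1) in auto)
  show ?thesis using 1 2
  proof eventually_elim
    case (elim r)
    show ?case
    proof (intro equalityI subsetI)
      fix x assume x: "x \<in> dimage D \<inter> cball c r"
      then obtain i t where it: "i < ncircles D" "x = curve D i t" "norm (curve D i t - c) \<le> r"
        by (auto simp: dimage_def dist_norm norm_minus_commute)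
      then obtain s k where sk: "(i, s) \<in> passes D c" "t + of_int k \<in> {s - d (i, s)..s + d (i, s)}"
        using elim(2) by blast
      have eq: "curve D i (t + of_int k) = x" using curve_periodic_int[OF D it(1)] it by simp
      then have "t + of_int k \<in> {entry_time D r (i, s)..exit_time D r (i, s)}"
        using elim(1) sk it unfolding P_def by fastforce
      then have "x \<in> strand D r (i, s)" using eq by (force simp: strand_def)
      then show "x \<in> (\<Union>p \<in> passes D c. strand D r p)" using sk by blast
    next
      fix x assume "x \<in> (\<Union>p \<in> passes D c. strand D r p)"
      then obtain p where p: "p \<in> passes D c" "x \<in> strand D r p" by blast
      then have "x \<in> cball c r" using elim(1) unfolding P_def by blast
      moreover have "x \<in> dimage D" using p unfolding strand_def dimage_def passes_def by fastforce
      ultimately show "x \<in> dimage D \<inter> cball c r" by blast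
    qed
  qed
qed

lemma leaves_disc:
  assumes D: "generic_immersion D" and i: "i < ncircles D"
  shows "\<forall>\<^sub>F r in at_right 0. \<not> range (curve D i) \<subseteq> ball c r"
proof -
  have "\<exists>t. curve D i t \<noteq> c"
  proof (rule ccontr)
    assume "\<not> ?thesis"
    then have "curve D i = (\<lambda>_. c)" by auto
    then show False using generic_immersionD(4)[OF D i, of 0] by simp
  qed
  then obtain t where "curve D i t \<noteq> c" ..
  then have "\<forall>\<^sub>F r in at_right 0. r < dist c (curve D i t)"
    using eventually_at_right_field by (metis zero_less_dist_iff)
  then show ?thesis by eventually_elim (auto simp: image_subset_iff not_less intro!: exI[of _ t])
qed

lemma discs_disjoint:
  fixes c c' :: "real ^ 2"
  assumes "c \<noteq> c'"
  shows "\<forall>\<^sub>F r in at_right 0. cball c r \<inter> cball c' r = {}"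
proof -
  have "\<forall>\<^sub>F r in at_right 0. r < dist c c' / 2"
    using assms eventually_at_right_field[of _ 0] by (metis half_gt_zero zero_less_dist_iff)
  then show ?thesis
  proof eventually_elim
    case (elim r)
    have False if "dist c x \<le> r" "dist c' x \<le> r" for x
      using that elim dist_triangle2[of c c' x] by (simp add: dist_commute)
    then show ?case by auto
  qed
qed

lemma eventually_smoothing_radius:
  assumes D: "generic_immersion D"
  shows "\<forall>\<^sub>F r in at_right 0. smoothing_radius D r"
proof -
  have fin: "finite (passes D c)" if "c \<in> crossings D" for c
    using generic_immersionD(6)[OF D that] by (metis card.infinite zero_neq_numeral)
  note finc = generic_immersionD(5)[OF D]
  have 0: "\<forall>\<^sub>F r in at_right (0::real). 0 < r" by (rule eventually_at_right_less)
  have 1: "\<forall>\<^sub>F r in at_right 0. \<forall>c\<in>crossings D. \<forall>c'\<in>crossings D. c \<noteq> c' \<longrightarrow> cball c r \<inter> cball c' r = {}"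
  proof (intro eventually_ball_finite finc ballI)
    fix c c' :: "real ^ 2" show "\<forall>\<^sub>F r in at_right 0. c \<noteq> c' \<longrightarrow> cball c r \<inter> cball c' r = {}"
      by (cases "c = c'") (use discs_disjoint in auto)
  qed
  have 2: "\<forall>\<^sub>F r in at_right 0. \<forall>i\<in>{..<ncircles D}. \<forall>c\<in>crossings D. \<not> range (curve D i) \<subseteq> ball c r"
    by (intro eventually_ball_finite finc ballI leaves_disc[OF D]) auto
  have 3: "\<forall>\<^sub>F r in at_right 0. \<forall>c\<in>crossings D. dimage D \<inter> cball c r = (\<Union>p \<in> passes D c. strand D r p)"
    by (intro eventually_ball_finite finc ballI disc_meets_strands[OF D])
  have 4: "\<forall>\<^sub>F r in at_right 0. \<forall>c\<in>crossings D. \<forall>p \<in> passes D c. \<forall>q \<in> passes D c.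
       p \<noteq> q \<longrightarrow> chord D r p q \<inter> chord D r q p = {}"
  proof (intro eventually_ball_finite finc fin ballI)
    fix c p q assume *: "c \<in> crossings D" "p \<in> passes D c" "q \<in> passes D c"
    show "\<forall>\<^sub>F r in at_right 0. p \<noteq> q \<longrightarrow> chord D r p q \<inter> chord D r q p = {}"
      by (cases "p = q") (use chords_disjoint[OF D *] in auto)
  qed
  show ?thesis using 0 1 2 3 4
    by eventually_elim (auto simp: smoothing_radius_def)
qed

lemma smoothing_radius_radius:
  assumes "generic_immersion D"
  shows "smoothing_radius D (radius D)"
proof -
  have "\<exists>r. smoothing_radius D r"
    using eventually_smoothing_radius[OF assms] by (rule eventually_happens'[rotated]) simp
  then show ?thesis unfolding radius_def by (rule someI_ex)
qed

end

theory Submission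
  imports Defs
begin

text \<open>
  If a set of Seifert circles is joined to the remaining ones by at most one crossing \<open>c\<close>, then
  undoing the smoothing at every other crossing leaves two disjoint closed pieces; so either the
  diagram is disconnected or \<open>c\<close> is nugatory. Hence the Seifert graph has no edge cut with fewer
  than two edges, and neither planarity nor bipartiteness is needed any more: every finite
  multigraph of this kind with \<open>V\<close> vertices and \<open>E\<close> edges has an independent set of at least
  \<open>V - 1 - E/2\<close> edges. Such a set is obtained by choosing successively vertices \<open>v\<close>, each with a
  neighbour \<open>w\<close> to which it is joined by a single edge, and deleting the closed neighbourhood of
  \<open>v\<close>: the edges chosen later stay away from everything that the stars of the earlier \<open>v\<close>
  collapse. The number of choices is bounded by induction on the number of vertices, splitting off
  minimal sets of vertices that are left by at most one edge.
\<close>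

text \<open>One choice is worth 4 and the excess is even, so the only loss that rounding can hide is
  2, half a choice. Setting one vertex aside as root makes the bound hereditary: contracting a set
  into the root keeps the cut condition, and the excess is additive. The graph has no cut of one
  edge, but without its root it may have some. A set \<open>W\<close> left by one edge, with end
  \<open>t\<close> in \<open>W\<close>, has at most 2 more excess with respect to the old root,
  which it must touch, than \<open>W - {t}\<close> has with root \<open>t\<close>. If the latter is
  2 modulo 4, rounding covers the difference; if it is divisible by 4, the edge leaving
  \<open>W\<close> has to be chosen as well, with \<open>t\<close> as centre of the star, and then
  the choices inside \<open>W\<close> must not have deleted \<open>t\<close>. So the induction has
  to control which vertices are chosen, not only how many, and it has to follow residues modulo
  4.\<close>

section \<open>Star sequences in multigraphs\<close>

text \<open>Loops are ignored, hence the zero diagonal.\<close>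
locale multiplicity_function =
  fixes m :: "'v \<Rightarrow> 'v \<Rightarrow> nat"
  assumes sym: "m a b = m b a" and irrefl [simp]: "m a a = 0"
begin

definition edges_between :: "'v set \<Rightarrow> 'v set \<Rightarrow> int" where
  "edges_between A B = (\<Sum>a\<in>A. \<Sum>b\<in>B. int (m a b))"

definition contacts :: "('v \<Rightarrow> nat) \<Rightarrow> 'v set \<Rightarrow> int" where
  "contacts c S = (\<Sum>v\<in>S. int (c v))"

text \<open>
  \<open>H\<close> is thought of as a graph with an additional root outside \<open>H\<close>, to which a vertex \<open>v\<close> is joined
  by \<open>c v\<close> edges. The condition says that this extended graph has no cut with fewer than two edges.
\<close>
definition cut_condition :: "'v set \<Rightarrow> ('v \<Rightarrow> nat) \<Rightarrow> bool" where
  "cut_condition H c \<longleftrightarrow> (\<forall>S\<subseteq>H. S \<noteq> {} \<longrightarrow> edges_between S (H - S) + contacts c S \<ge> 2)"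

text \<open>
  For the extended graph, with \<open>V\<close> vertices and \<open>E\<close> edges, this is \<open>4 * (V - 1 - E/2)\<close>; the sum
  \<open>edges_between H H\<close> counts every edge twice.
\<close>
definition excess :: "'v set \<Rightarrow> ('v \<Rightarrow> nat) \<Rightarrow> int" where
  "excess H c = 4 * int (card H) - edges_between H H - 2 * contacts c H"

text \<open>\<open>U\<close> restricts only the centres \<open>v\<close>: the neighbours of a centre
  disappear, so a centre is forbidden when some neighbour of it has to survive. The partner
  \<open>w\<close> is merely one of the vertices that disappear.\<close>

inductive star_sequence :: "'v set \<Rightarrow> 'v set \<Rightarrow> nat \<Rightarrow> bool" where
  seq_0: "star_sequence H U 0"
| seq_Suc: "v \<in> H \<Longrightarrow> v \<notin> U \<Longrightarrow> w \<in> H \<Longrightarrow> m v w = 1 \<Longrightarrow>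
    star_sequence {x \<in> H. x \<noteq> v \<and> m v x = 0} U k \<Longrightarrow> star_sequence H U (Suc k)"

section \<open>Edge counts, contraction into the root, isolated parts\<close>

lemma edges_between_nonneg [simp]: "edges_between A B \<ge> 0"
  by (simp add: edges_between_def sum_nonneg)

lemma contacts_nonneg [simp]: "contacts c S \<ge> 0"
  by (simp add: contacts_def sum_nonneg)

lemma edges_between_empty [simp]: "edges_between {} B = 0" "edges_between A {} = 0"
  by (simp_all add: edges_between_def)

lemma contacts_empty [simp]: "contacts c {} = 0"
  by (simp add: contacts_def)

lemma edges_between_sym: "edges_between A B = edges_between B A"
  unfolding edges_between_def by (subst sum.swap) (simp add: sym)

lemma edges_between_Un_left: "finite A \<Longrightarrow> finite A' \<Longrightarrow> A \<inter> A' = {} \<Longrightarrow> edges_between (A \<union> A') B = edges_between A B + edges_between A' B"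
  by (simp add: edges_between_def sum.union_disjoint)

lemma edges_between_Un_right: "finite A \<Longrightarrow> finite A' \<Longrightarrow> A \<inter> A' = {} \<Longrightarrow> edges_between B (A \<union> A') = edges_between B A + edges_between B A'"
  using edges_between_Un_left edges_between_sym by metis

lemma contacts_Un: "finite A \<Longrightarrow> finite A' \<Longrightarrow> A \<inter> A' = {} \<Longrightarrow> contacts c (A \<union> A') = contacts c A + contacts c A'"
  by (simp add: contacts_def sum.union_disjoint)

lemma edges_between_split_left: "finite A \<Longrightarrow> S \<subseteq> A \<Longrightarrow> edges_between A B = edges_between S B + edges_between (A - S) B"
  using edges_between_Un_left[of S "A - S" B] finite_subset[of S A] by (simp add: Un_absorb1)

lemma edges_between_split_right: "finite A \<Longrightarrow> S \<subseteq> A \<Longrightarrow> edges_between B A = edges_between B S + edges_between B (A - S)"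
  using edges_between_split_left edges_between_sym by metis

lemma contacts_split: "finite A \<Longrightarrow> S \<subseteq> A \<Longrightarrow> contacts c A = contacts c S + contacts c (A - S)"
  using contacts_Un[of S "A - S" c] finite_subset[of S A] by (simp add: Un_absorb1)

lemma edges_between_mono: "finite A' \<Longrightarrow> finite B' \<Longrightarrow> A \<subseteq> A' \<Longrightarrow> B \<subseteq> B' \<Longrightarrow> edges_between A B \<le> edges_between A' B'"
  using edges_between_split_left[of A' A B] edges_between_split_right[of B' B A'] edges_between_nonneg
  by (metis add_increasing2 dual_order.refl)

lemma edges_between_self_even: "finite A \<Longrightarrow> even (edges_between A A)"
proof (induction A rule: finite_induct)
  case (insert x A)
  have "edges_between (insert x A) (insert x A) = edges_between {x} {x} + 2 * edges_between {x} A + edges_between A A"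
    using insert edges_between_Un_left[of "{x}" A] edges_between_Un_right[of "{x}" A] edges_between_sym[of A "{x}"] by simp
  then show ?case using insert by (simp add: edges_between_def)
qed simp

lemma edges_between_0D: "finite A \<Longrightarrow> finite B \<Longrightarrow> edges_between A B = 0 \<Longrightarrow> a \<in> A \<Longrightarrow> b \<in> B \<Longrightarrow> m a b = 0"
  unfolding edges_between_def by (subst (asm) sum_nonneg_eq_0_iff) (auto intro!: sum_nonneg simp: sum_nonneg_eq_0_iff)

text \<open>Edges inside \<open>K\<close> or from \<open>K\<close> to the root are counted in the
  second summand, all others in the first, and the root belongs to both graphs; so
  \<open>V - 1\<close> and \<open>E\<close> are both additive.\<close>

lemma excess_contract:
  assumes "finite H" "K \<subseteq> H"
  shows "excess H c = excess (H - K) (\<lambda>v. c v + (\<Sum>a\<in>K. m v a)) + excess K c"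
proof -
  have fK: "finite K" using assms finite_subset by blast
  have 1: "edges_between H H = edges_between K K + 2 * edges_between (H - K) K + edges_between (H - K) (H - K)"
    using assms by (simp add: edges_between_split_left[of H K] edges_between_split_right[of H K] edges_between_sym[of K "H - K"])
  have 2: "contacts (\<lambda>v. c v + (\<Sum>a\<in>K. m v a)) (H - K) = contacts c (H - K) + edges_between (H - K) K"
    by (simp add: contacts_def edges_between_def sum.distrib)
  have 3: "int (card H) = int (card (H - K)) + int (card K)"
    using assms fK by (simp add: card_Diff_subset card_mono of_nat_diff)
  show ?thesis unfolding excess_def 1 2 3 contacts_split[OF assms] by simp
qed

lemma contacts_contract: "contacts (\<lambda>v. c v + (\<Sum>a\<in>K. m v a)) S = contacts c S + edges_between S K"
  by (simp add: contacts_def edges_between_def sum.distrib)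

text \<open>A set in \<open>H - K\<close> keeps its boundary; its edges to \<open>K\<close> are only
  recounted as contacts.\<close>

lemma cut_condition_contract:
  assumes "cut_condition H c" "finite H" "K \<subseteq> H"
  shows "cut_condition (H - K) (\<lambda>v. c v + (\<Sum>a\<in>K. m v a))"
  unfolding cut_condition_def
proof (intro allI impI)
  fix S assume S: "S \<subseteq> H - K" "S \<noteq> {}"
  have "H - S - K = H - K - S" by blast
  then have "edges_between S (H - S) = edges_between S K + edges_between S (H - K - S)"
    using edges_between_split_right[of "H - S" K S] S assms by auto
  moreover have "edges_between S (H - S) + contacts c S \<ge> 2"
    using assms S unfolding cut_condition_def by blast
  ultimately show "edges_between S (H - K - S) + contacts (\<lambda>v. c v + (\<Sum>a\<in>K. m v a)) S \<ge> 2"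
    by (simp add: contacts_contract)
qed

lemma contacts_cong: "(\<And>v. v \<in> S \<Longrightarrow> c v = c' v) \<Longrightarrow> contacts c S = contacts c' S"
  by (simp add: contacts_def)

lemma contacts_ge: "finite S \<Longrightarrow> v \<in> S \<Longrightarrow> contacts c S \<ge> int (c v)"
  unfolding contacts_def by (rule member_le_sum) auto

text \<open>The two parts meet only at the root, so cuts and counts separate.\<close>

lemma cut_condition_component:
  assumes "cut_condition H c" "finite H" "S \<subseteq> H" "edges_between S (H - S) = 0"
  shows "cut_condition S c" and "excess H c = excess S c + excess (H - S) c" and "cut_condition (H - S) c"
proof -
  have z: "m v a = 0" if "v \<in> H - S" "a \<in> S" for v a
    using edges_between_0D[of S "H - S" a v] assms that finite_subset[of S H] sym[of v a] by auto
  then have zz: "(\<Sum>a\<in>S. m v a) = 0" if "v \<in> H - S" for v using that by simp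
  have "contacts (\<lambda>v. c v + (\<Sum>a\<in>S. m v a)) R = contacts c R" if "R \<subseteq> H - S" for R
    using that zz by (intro contacts_cong) auto
  then have c: "contacts (\<lambda>v. c v + (\<Sum>a\<in>S. m v a)) R = contacts c R" if "R \<subseteq> H - S" for R using that by blast
  show "excess H c = excess S c + excess (H - S) c"
    using excess_contract[of H S c] c[of "H - S"] assms unfolding excess_def by simp
  show "cut_condition (H - S) c"
    using cut_condition_contract[of H c S] c assms unfolding cut_condition_def by auto
  show "cut_condition S c" unfolding cut_condition_def
  proof (intro allI impI)
    fix R assume R: "R \<subseteq> S" "R \<noteq> {}"
    have "H - R - (S - R) = H - S" using R by blast
    then have "edges_between R (H - R) = edges_between R (S - R) + edges_between R (H - S)"
      using edges_between_split_right[of "H - R" "S - R" R] assms R by auto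
    moreover have "edges_between R (H - S) \<le> edges_between S (H - S)"
      using edges_between_mono[of S "H - S" R "H - S"] R assms finite_subset[of S H] by auto
    moreover have "edges_between R (H - R) + contacts c R \<ge> 2" using assms R unfolding cut_condition_def by blast
    ultimately show "edges_between R (S - R) + contacts c R \<ge> 2" using assms(4) edges_between_nonneg[of R "H - S"] by linarith
  qed
qed

section \<open>Restricting and joining star sequences\<close>

lemma star_sequence_mono: "star_sequence H U k \<Longrightarrow> H \<subseteq> H' \<Longrightarrow> U' \<subseteq> U \<Longrightarrow> star_sequence H' U' k"
proof (induction arbitrary: H' rule: star_sequence.induct)
  case (seq_Suc v H U w k)
  have "star_sequence {x \<in> H'. x \<noteq> v \<and> m v x = 0} U' k"
    by (rule seq_Suc.IH) (use seq_Suc.prems in auto)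
  then show ?case using seq_Suc by (intro star_sequence.seq_Suc[of v _ _ w]) auto
qed (rule seq_0)

text \<open>\<open>V\<close> holds every vertex of \<open>A\<close> that has a neighbour in
  \<open>B\<close>. The first sequence takes no such vertex as a centre, hence deletes nothing of
  \<open>B\<close>, even if its partners touch \<open>B\<close>.\<close>

lemma star_sequence_append:
  "star_sequence A V j \<Longrightarrow> (\<And>v b. v \<in> A \<Longrightarrow> v \<notin> V \<Longrightarrow> b \<in> B \<Longrightarrow> v \<noteq> b \<and> m v b = 0) \<Longrightarrow> A \<inter> U \<subseteq> V \<Longrightarrow>
    star_sequence B U k \<Longrightarrow> star_sequence (A \<union> B) U (j + k)"
proof (induction rule: star_sequence.induct)
  case (seq_0 H V)
  then show ?case using star_sequence_mono by auto
next
  case (seq_Suc v A V w j)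
  have "star_sequence ({x \<in> A. x \<noteq> v \<and> m v x = 0} \<union> B) U (j + k)"
    by (rule seq_Suc.IH) (use seq_Suc.prems in auto)
  moreover have "{x \<in> A. x \<noteq> v \<and> m v x = 0} \<union> B = {x \<in> A \<union> B. x \<noteq> v \<and> m v x = 0}"
    using seq_Suc.prems(1) seq_Suc.hyps by blast
  ultimately have "star_sequence {x \<in> A \<union> B. x \<noteq> v \<and> m v x = 0} U (j + k)" by simp
  then have "star_sequence (A \<union> B) U (Suc (j + k))"
    using seq_Suc.hyps seq_Suc.prems by (intro star_sequence.seq_Suc[of v _ _ w]) auto
  then show ?case by simp
qed

section \<open>Sets left by at most one edge\<close>

lemma edges_between_1D:
  assumes "finite A" "finite B" "edges_between A B = 1"
  shows "\<exists>t\<in>A. \<exists>b\<in>B. m t b = 1 \<and> (\<forall>v\<in>A. \<forall>x\<in>B. v \<noteq> t \<or> x \<noteq> b \<longrightarrow> m v x = 0)"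
proof -
  have e: "edges_between A B = int (\<Sum>p\<in>A \<times> B. m (fst p) (snd p))"
    unfolding edges_between_def by (simp add: sum.cartesian_product case_prod_unfold)
  then have "(\<Sum>p\<in>A \<times> B. m (fst p) (snd p)) = 1" using assms(3) by (metis of_nat_1_eq_iff)
  then have "\<exists>p\<in>A \<times> B. m (fst p) (snd p) = 1 \<and> (\<forall>q\<in>A \<times> B. p \<noteq> q \<longrightarrow> m (fst q) (snd q) = 0)"
    using assms by (subst (asm) sum_eq_1_iff) auto
  then show ?thesis by force
qed

text \<open>By minimality every nonempty proper subset of \<open>W\<close> is left by at least two
  edges. Adding this for \<open>R\<close> and \<open>W - R\<close> counts the edges between them
  twice and those leaving \<open>W\<close>, at most one, once; so twice the former number is \<ge>
  3, and integrality gives two edges. Hence any vertex of \<open>W\<close> can be its root.\<close>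

lemma minimal_cut:
  assumes "finite H" "S \<subseteq> H" "S \<noteq> {}" "edges_between S (H - S) \<le> 1"
  obtains W where "W \<subseteq> S" "W \<noteq> {}" "edges_between W (H - W) \<le> 1" "\<And>t. t \<in> W \<Longrightarrow> cut_condition (W - {t}) (m t)"
proof -
  let ?P = "\<lambda>W. W \<subseteq> S \<and> W \<noteq> {} \<and> edges_between W (H - W) \<le> 1"
  have "?P S" using assms by blast
  from ex_has_least_nat[of ?P, OF this, of card]
  obtain W where W': "?P W \<and> (\<forall>W'. ?P W' \<longrightarrow> card W \<le> card W')" by (elim exE)
  then have W: "?P W" and min: "\<And>W'. ?P W' \<Longrightarrow> card W \<le> card W'" by auto
  have fW: "finite W" using W assms finite_subset by metis
  have ge: "edges_between R (H - R) \<ge> 2" if "R \<subset> W" "R \<noteq> {}" for R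
  proof (rule ccontr)
    assume "\<not> edges_between R (H - R) \<ge> 2"
    then have "?P R" using that W by auto
    then show False using min[of R] psubset_card_mono[OF fW that(1)] by simp
  qed
  have "cut_condition (W - {t}) (m t)" if t: "t \<in> W" for t
    unfolding cut_condition_def
  proof (intro allI impI)
    fix R assume R: "R \<subseteq> W - {t}" "R \<noteq> {}"
    let ?Q = "W - R"
    have fR: "finite R" using R fW finite_subset by blast
    have "R \<subset> W" "?Q \<subset> W" "?Q \<noteq> {}" using R t by auto
    then have 1: "edges_between R (H - R) \<ge> 2" "edges_between ?Q (H - ?Q) \<ge> 2" using ge R(2) by blast+
    have "H - R - ?Q = H - W" using R by blast
    then have 2: "edges_between R (H - R) = edges_between R ?Q + edges_between R (H - W)"
      using edges_between_split_right[of "H - R" ?Q R] assms W by auto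
    have "H - ?Q - R = H - W" using R W assms by blast
    then have 3: "edges_between ?Q (H - ?Q) = edges_between ?Q R + edges_between ?Q (H - W)"
      using edges_between_split_right[of "H - ?Q" R ?Q] assms W R by auto
    have 4: "edges_between W (H - W) = edges_between R (H - W) + edges_between ?Q (H - W)"
      using edges_between_split_left[of W R] fW R by auto
    have 5: "edges_between R ?Q = edges_between R (W - {t} - R) + contacts (m t) R"
    proof -
      have e: "edges_between R {t} = contacts (m t) R" by (simp add: edges_between_def contacts_def sym)
      have d: "?Q - {t} = W - {t} - R" by blast
      have "edges_between R ?Q = edges_between R {t} + edges_between R (?Q - {t})"
        by (rule edges_between_split_right) (use fW R t in auto)
      then show ?thesis unfolding e d by simp
    qed
    have "edges_between R ?Q \<ge> 2" using 1 2 3 4 W edges_between_sym[of R ?Q] edges_between_nonneg[of R "H - W"] edges_between_nonneg[of ?Q "H - W"]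
      by linarith
    then show "edges_between R (W - {t} - R) + contacts (m t) R \<ge> 2" using 5 by simp
  qed
  then show ?thesis using that W by blast
qed

section \<open>Star sequences attaining the excess\<close>

text \<open>
  The following four properties are proved by a simultaneous induction. Besides the bound itself
  one needs to know which vertices the sequence can avoid: a vertex \<open>v\<close> joined to the root cannot be
  used when an edge at the root is still to be chosen, since that would delete the root.
\<close>

definition avoids_vertex :: "'v set \<Rightarrow> bool" where
  "avoids_vertex H \<longleftrightarrow> (\<forall>c u. cut_condition H c \<longrightarrow> (\<exists>k. star_sequence H {u} k \<and> 4 * int k \<ge> excess H c))"

text \<open>If the excess is 2 modulo 4, rounding already gains half a choice. In the divisible case
  treated here the gain is a whole choice, or else the root survives because none of its neighbours
  is a centre.\<close>

definition avoids_contacts :: "'v set \<Rightarrow> bool" where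
  "avoids_contacts H \<longleftrightarrow> (\<forall>c. cut_condition H c \<longrightarrow> 4 dvd excess H c \<longrightarrow>
     (\<exists>k. star_sequence H {} k \<and> 4 * int k \<ge> excess H c + 4) \<or> (\<exists>k. star_sequence H {v. c v > 0} k \<and> 4 * int k \<ge> excess H c))"

definition connected_host :: "'v set \<Rightarrow> bool" where
  "connected_host H \<longleftrightarrow> (\<forall>S\<subseteq>H. S \<noteq> {} \<longrightarrow> S \<noteq> H \<longrightarrow> edges_between S (H - S) > 0)"

text \<open>Edges to the root are disregarded in these cuts. Splitting along one of them leaves a
  piece in which a single vertex of \<open>Y\<close> is to be avoided, and
  \<open>avoids_vertex\<close> handles that.\<close>

definition private_cuts :: "'v set \<Rightarrow> 'v set \<Rightarrow> bool" where
  "private_cuts H Y \<longleftrightarrow> Y \<subseteq> H \<and> (\<forall>y\<in>Y. \<exists>S\<subseteq>H. S \<inter> Y = {y} \<and> edges_between S (H - S) \<le> 1)"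

definition avoids_private :: "'v set \<Rightarrow> bool" where
  "avoids_private H \<longleftrightarrow> (\<forall>Y. connected_host H \<longrightarrow> cut_condition H (\<lambda>v. of_bool (v \<in> Y)) \<longrightarrow> private_cuts H Y \<longrightarrow>
     (\<exists>k. star_sequence H Y k \<and> 4 * int k + 2 \<ge> excess H (\<lambda>v. of_bool (v \<in> Y))))"

text \<open>The strict inequality gives every isolated part a contact beyond one for each of its
  vertices in \<open>Y\<close>. This contact is worth 2, exactly the loss that
  \<open>avoids_private\<close> allows.\<close>

definition avoids_part :: "'v set \<Rightarrow> bool" where
  "avoids_part H \<longleftrightarrow> (\<forall>c Y. cut_condition H c \<longrightarrow> private_cuts H Y \<longrightarrow> (\<forall>y\<in>Y. c y \<ge> 1) \<longrightarrow>
     (\<forall>S\<subseteq>H. S \<noteq> {} \<longrightarrow> edges_between S (H - S) = 0 \<longrightarrow> contacts c S > int (card (S \<inter> Y))) \<longrightarrow>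
     (\<exists>k. star_sequence H Y k \<and> 4 * int k \<ge> excess H c))"

lemma excess_even: "finite H \<Longrightarrow> even (excess H c)"
  by (simp add: excess_def edges_between_self_even)

text \<open>Making \<open>t\<close> the root drops one vertex, worth 4, and the old contacts, worth
  2 each.\<close>

lemma excess_remove_root:
  assumes "finite W" "t \<in> W"
  shows "excess W c = excess (W - {t}) (m t) + 4 - 2 * contacts c W"
proof -
  have "(\<lambda>v. m v t) = m t" using sym by blast
  then have "excess W (\<lambda>_. 0) = excess (W - {t}) (m t) + 4"
    using excess_contract[of W "{t}" "\<lambda>_. 0"] assms by (simp add: excess_def[of "{t}"] edges_between_def contacts_def)
  then show ?thesis by (simp add: excess_def contacts_def)
qed

lemma cut_conditionD: "cut_condition H c \<Longrightarrow> S \<subseteq> H \<Longrightarrow> S \<noteq> {} \<Longrightarrow> edges_between S (H - S) + contacts c S \<ge> 2"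
  unfolding cut_condition_def by blast

text \<open>
  The set \<open>W\<close> is left by a single edge, from \<open>t\<close> to \<open>b\<close>. If the excess of \<open>W\<close> rooted at \<open>t\<close> is not
  divisible by 4, rounding gains the missing half step and \<open>W\<close> can be split off; otherwise a sequence
  in \<open>W\<close> that does not delete \<open>t\<close> is continued with the pair \<open>t\<close>, \<open>b\<close>.
\<close>
lemma leaf_step:
  assumes fin: "finite H" and W: "W \<subseteq> H" and cut_condition: "\<And>t. t \<in> W \<Longrightarrow> cut_condition (W - {t}) (m t)"
    and cut: "edges_between W (H - W) = 1" and c: "contacts c W \<ge> 1"
    and IH: "\<And>t. t \<in> W \<Longrightarrow> avoids_vertex (W - {t}) \<and> avoids_contacts (W - {t})"
  obtains K g where "W \<subseteq> K" "K \<subseteq> H" "4 * int g \<ge> excess K c"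
    "\<And>U k. U \<inter> W = {} \<Longrightarrow> star_sequence (H - K) U k \<Longrightarrow> star_sequence H U (g + k)"
proof -
  note result = that
  have fW: "finite W" using fin W finite_subset by blast
  obtain t b where tb: "t \<in> W" "b \<in> H - W" "m t b = 1"
    and z: "\<And>v x. v \<in> W \<Longrightarrow> x \<in> H - W \<Longrightarrow> v \<noteq> t \<or> x \<noteq> b \<Longrightarrow> m v x = 0"
    using edges_between_1D[OF fW finite_Diff[OF fin] cut] by blast
  let ?\<tau> = "excess (W - {t}) (m t)"
  have TW: "excess W c = ?\<tau> + 4 - 2 * contacts c W" by (rule excess_remove_root[OF fW tb(1)])
  have whole: thesis if s: "star_sequence (W - {t}) {} g" and g: "4 * int g \<ge> ?\<tau> + 2" for g
  proof (rule result[of W g])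
    fix U k assume U: "U \<inter> W = {}" and k: "star_sequence (H - W) U k"
    have "star_sequence ((W - {t}) \<union> (H - W)) U (g + k)"
      by (rule star_sequence_append[OF s _ _ k]) (use z U in auto)
    then show "star_sequence H U (g + k)" by (rule star_sequence_mono) (use W in auto)
  qed (use tb z W g TW c in auto)
  \<comment> \<open>Any vertex may be the avoided one, hence \<open>undefined\<close>.\<close>
  obtain g where g: "star_sequence (W - {t}) {undefined} g" "4 * int g \<ge> ?\<tau>"
    using IH[OF tb(1)] cut_condition[OF tb(1)] unfolding avoids_vertex_def by blast
  have g': "star_sequence (W - {t}) {} g" using g(1) star_sequence_mono by blast
  show thesis
  proof (cases "4 dvd ?\<tau>")
    case False
    have "even ?\<tau>" using excess_even fW by simp
    then have "4 * int g \<ge> ?\<tau> + 2" using False g(2) by presburger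
    then show thesis by (rule whole[OF g'])
  next
    case True
    then consider k where "star_sequence (W - {t}) {} k" "4 * int k \<ge> ?\<tau> + 4"
      | k where "star_sequence (W - {t}) {v. m t v > 0} k" "4 * int k \<ge> ?\<tau>"
      using IH[OF tb(1)] cut_condition[OF tb(1)] unfolding avoids_contacts_def by blast
    then show thesis
    proof cases
      case (1 k)
      then show thesis by (intro whole[of k]) auto
    next
      case (2 g)
      let ?K = "insert b W"
      have edb: "edges_between W {b} = 1"
        using tb z by (simp add: edges_between_def sum.remove[OF fW tb(1)])
      have "edges_between ?K ?K = edges_between W W + 2"
        using edges_between_Un_left[of "{b}" W ?K] edges_between_Un_right[of "{b}" W] fW tb edb edges_between_sym[of W "{b}"]
        by (simp add: edges_between_def[of "{b}" "{b}"])
      \<comment> \<open>The vertex \<open>b\<close> brings 4; the edge from \<open>t\<close> to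
        \<open>b\<close> takes 2, and so does each contact of \<open>b\<close>.\<close>
      then have "excess ?K c = excess W c + 2 - 2 * int (c b)"
        using tb fW by (simp add: excess_def contacts_def)
      then have TK: "excess ?K c \<le> 4 * int (Suc g)" using TW 2(2) c by simp
      show thesis
      proof (rule result[of ?K "Suc g"])
        fix U k assume U: "U \<inter> W = {}" and k: "star_sequence (H - ?K) U k"
        \<comment> \<open>Outside \<open>W\<close> the only neighbour of \<open>t\<close> is
          \<open>b\<close>, so the star of \<open>t\<close> spares \<open>H - ?K\<close>.\<close>
        have "star_sequence ({t, b} \<union> (H - ?K)) U (Suc k)"
        proof (rule seq_Suc[of t _ _ b])
          show "star_sequence {x \<in> {t, b} \<union> (H - ?K). x \<noteq> t \<and> m t x = 0} U k"
            by (rule star_sequence_mono[OF k]) (use tb z in auto)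
        qed (use tb U in auto)
        then have "star_sequence ((W - {t}) \<union> ({t, b} \<union> (H - ?K))) U (g + Suc k)"
        proof (rule star_sequence_append[OF 2(1), rotated 2])
          fix v x assume "v \<in> W - {t}" "v \<notin> {v. m t v > 0}" "x \<in> {t, b} \<union> (H - ?K)"
          then show "v \<noteq> x \<and> m v x = 0" using z[of v x] tb sym[of v t] by auto
        qed (use U in auto)
        then have "star_sequence H U (g + Suc k)" by (rule star_sequence_mono) (use W tb in auto)
        then show "star_sequence H U (Suc g + k)" by simp
      qed (use tb z W TK in auto)
    qed
  qed
qed


lemma star_sequence_forbid: "star_sequence A V j \<Longrightarrow> A \<inter> U \<subseteq> V \<Longrightarrow> star_sequence A U j"
  using star_sequence_append[of A V j "{}" U 0] seq_0 by simp

lemma star_sequence_split: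
  assumes "finite H" "S \<subseteq> H" "edges_between S (H - S) = 0" "star_sequence S U j" "star_sequence (H - S) U k"
  shows "star_sequence H U (j + k)"
proof -
  have "m v b = 0" if "v \<in> S" "b \<in> H - S" for v b
    using edges_between_0D[of S "H - S" v b] assms that finite_subset by blast
  then have "star_sequence (S \<union> (H - S)) U (j + k)"
    by (intro star_sequence_append[OF assms(4) _ _ assms(5)]) auto
  then show ?thesis using assms(2) by (simp add: Un_absorb1)
qed

lemma cut_condition_root:
  assumes fin: "finite H" and u: "u \<in> H"
    and S: "\<And>S. S \<subseteq> H - {u} \<Longrightarrow> S \<noteq> {} \<Longrightarrow> edges_between S (H - S) \<ge> 2"
  shows "cut_condition (H - {u}) (m u)"
  unfolding cut_condition_def
proof (intro allI impI)
  fix S assume *: "S \<subseteq> H - {u}" "S \<noteq> {}"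
  have "edges_between S (H - S) = edges_between S {u} + edges_between S (H - S - {u})"
    by (rule edges_between_split_right) (use * u fin in auto)
  moreover have "H - S - {u} = H - {u} - S" by blast
  moreover have "edges_between S {u} = contacts (m u) S" by (simp add: edges_between_def contacts_def sym)
  ultimately show "edges_between S (H - {u} - S) + contacts (m u) S \<ge> 2" using S[OF *] by simp
qed

text \<open>If no small cut misses \<open>u\<close>, then \<open>u\<close> can become the root and
  so is never chosen; the old contacts, at least two, pay for the lost vertex. Otherwise a minimal
  cut missing \<open>u\<close> is split off, and the induction hypothesis treats the rest.\<close>

lemma avoids_vertex_step:
  assumes fin: "finite H" and IH: "\<And>R. R \<subset> H \<Longrightarrow> avoids_vertex R \<and> avoids_contacts R"
  shows "avoids_vertex H"
  unfolding avoids_vertex_def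
proof (intro allI impI)
  fix c u assume cut_condition: "cut_condition H c"
  show "\<exists>k. star_sequence H {u} k \<and> 4 * int k \<ge> excess H c"
  proof (cases "\<exists>S. S \<subseteq> H - {u} \<and> S \<noteq> {} \<and> edges_between S (H - S) \<le> 1")
    case True
    then obtain S where S: "S \<subseteq> H - {u}" "S \<noteq> {}" "edges_between S (H - S) \<le> 1" by blast
    have "S \<subseteq> H" using S by blast
    from minimal_cut[OF fin this S(2,3)] obtain W where W: "W \<subseteq> S" "W \<noteq> {}" "edges_between W (H - W) \<le> 1"
      "\<And>t. t \<in> W \<Longrightarrow> cut_condition (W - {t}) (m t)" by blast
    have WH: "W \<subseteq> H" "u \<notin> W" using W S by auto
    have fW: "finite W" using WH fin finite_subset by blast
    have c2: "edges_between W (H - W) + contacts c W \<ge> 2" using cut_condition WH W unfolding cut_condition_def by blast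
    obtain t where t: "t \<in> W" using W by blast
    show ?thesis
    proof (cases "edges_between W (H - W) = 0")
      case True
      have "W - {t} \<subset> H" "H - W \<subset> H" using WH t by auto
      with IH have IH': "avoids_vertex (W - {t})" "avoids_vertex (H - W)" by blast+
      note co = cut_condition_component[OF cut_condition fin WH(1) True]
      obtain j where j: "star_sequence (W - {t}) {u} j" "4 * int j \<ge> excess (W - {t}) (m t)"
        using IH'(1) W(4)[OF t] unfolding avoids_vertex_def by blast
      obtain k where k: "star_sequence (H - W) {u} k" "4 * int k \<ge> excess (H - W) c"
        using IH'(2) co(3) unfolding avoids_vertex_def by blast
      have "star_sequence W {u} j" using star_sequence_mono[OF j(1)] by blast
      then have "star_sequence H {u} (j + k)" using star_sequence_split[OF fin WH(1) True _ k(1)] by blast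
      \<comment> \<open>The isolated set \<open>W\<close> has two contacts, which make up for the
        vertex \<open>t\<close> turned into a root.\<close>
      moreover have "4 * int (j + k) \<ge> excess H c"
        using j(2) k(2) co(2) excess_remove_root[OF fW t, of c] c2 True by simp
      ultimately show ?thesis by blast
    next
      case False
      then have cut: "edges_between W (H - W) = 1" using W(3) edges_between_nonneg[of W "H - W"] by linarith
      have IH': "avoids_vertex (W - {t}) \<and> avoids_contacts (W - {t})" if "t \<in> W" for t
        using IH[of "W - {t}"] WH that by blast
      have "contacts c W \<ge> 1" using c2 cut by simp
      then obtain K g where K: "W \<subseteq> K" "K \<subseteq> H" "4 * int g \<ge> excess K c"
        "\<And>U k. U \<inter> W = {} \<Longrightarrow> star_sequence (H - K) U k \<Longrightarrow> star_sequence H U (g + k)"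
        using leaf_step[OF fin WH(1) W(4) cut _ IH'] by metis
      have "H - K \<subset> H" using K W by blast
      then obtain k where k: "star_sequence (H - K) {u} k"
        "4 * int k \<ge> excess (H - K) (\<lambda>v. c v + (\<Sum>a\<in>K. m v a))"
        using IH cut_condition_contract[OF cut_condition fin K(2)] unfolding avoids_vertex_def by blast
      have "star_sequence H {u} (g + k)" using K(4) k(1) WH(2) by blast
      moreover have "4 * int (g + k) \<ge> excess H c"
        using K(3) k(2) excess_contract[OF fin K(2), of c] by simp
      ultimately show ?thesis by blast
    qed
  next
    case False
    have S: "edges_between S (H - S) \<ge> 2" if "S \<subseteq> H - {u}" "S \<noteq> {}" for S
    proof (rule ccontr)
      assume "\<not> edges_between S (H - S) \<ge> 2"
      then have "edges_between S (H - S) \<le> 1" by simp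
      then show False using False that by blast
    qed
    show ?thesis
    proof (cases "u \<in> H")
      case True
      then obtain k where k: "star_sequence (H - {u}) {u} k" "4 * int k \<ge> excess (H - {u}) (m u)"
        using IH[of "H - {u}"] cut_condition_root[OF fin True S] unfolding avoids_vertex_def by blast
      have "contacts c H \<ge> 2" using cut_conditionD[OF cut_condition, of H] True by auto
      then have "4 * int k \<ge> excess H c" using k(2) excess_remove_root[OF fin True, of c] by simp
      then show ?thesis using star_sequence_mono[OF k(1)] by blast
    next
      case u: False
      \<comment> \<open>Otherwise \<open>H\<close> itself would be a set missing \<open>u\<close>
        and left by no edge.\<close>
      then have "H = {}" using S[of H] by auto
      then show ?thesis by (intro exI[of _ 0]) (simp add: excess_def seq_0)
    qed
  qed
qed

section \<open>Avoiding vertices that have private cuts\<close>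

lemma private_cuts_restrict:
  assumes "finite H" "private_cuts H Y" "R \<subseteq> H"
  shows "private_cuts R (Y \<inter> R)"
  unfolding private_cuts_def
proof (intro conjI ballI)
  fix y assume y: "y \<in> Y \<inter> R"
  then obtain S where S: "S \<subseteq> H" "S \<inter> Y = {y}" "edges_between S (H - S) \<le> 1"
    using assms(2) unfolding private_cuts_def by blast
  have "edges_between (S \<inter> R) (R - S \<inter> R) \<le> edges_between S (H - S)"
    by (rule edges_between_mono) (use S assms finite_subset[of S H] in auto)
  then show "\<exists>S\<subseteq>R. S \<inter> (Y \<inter> R) = {y} \<and> edges_between S (R - S) \<le> 1"
    using S y by (intro exI[of _ "S \<inter> R"]) auto
qed simp

lemma connected_host_contract:
  assumes "finite H" "connected_host H" "K \<subseteq> H" "K \<noteq> {}" "S \<subseteq> H - K" "S \<noteq> {}" "edges_between S (H - K - S) = 0"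
  shows "edges_between S K > 0"
proof -
  have "edges_between S (H - S) = edges_between S K + edges_between S (H - S - K)"
    by (rule edges_between_split_right) (use assms in auto)
  moreover have "H - S - K = H - K - S" by blast
  moreover have "edges_between S (H - S) > 0" using assms unfolding connected_host_def by blast
  ultimately show ?thesis using assms by simp
qed

lemma contacts_of_bool: "finite S \<Longrightarrow> contacts (\<lambda>v. of_bool (v \<in> Y)) S = int (card (S \<inter> Y))"
  by (simp add: contacts_def sum_of_bool_eq)

lemma contacts_ge_card:
  assumes "finite S" "\<And>y. y \<in> Y \<Longrightarrow> c y \<ge> 1"
  shows "contacts c S \<ge> int (card (S \<inter> Y))"
proof -
  have "contacts (\<lambda>v. of_bool (v \<in> Y)) S \<le> contacts c S"
    unfolding contacts_def by (rule sum_mono) (use assms in \<open>auto simp: of_bool_def\<close>)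
  then show ?thesis using contacts_of_bool assms by metis
qed

text \<open>As \<open>H\<close> is connected, every isolated part of \<open>H - K\<close> has an
  edge to \<open>K\<close>. Counted as a contact, it supplies the strict inequality in
  \<open>avoids_part\<close>.\<close>

lemma avoids_part_contract:
  fixes c :: "'v \<Rightarrow> nat"
  assumes fin: "finite H" and connected_host: "connected_host H" and cut_condition: "cut_condition H c" and p: "private_cuts H Y"
    and c: "\<And>y. y \<in> Y \<Longrightarrow> c y \<ge> 1" and K: "K \<subseteq> H" "K \<noteq> {}" and part: "avoids_part (H - K)"
  obtains k where "star_sequence (H - K) Y k" "4 * int k \<ge> excess H c - excess K c"
proof -
  let ?c = "\<lambda>v. c v + (\<Sum>a\<in>K. m v a)"
  have "contacts ?c S > int (card (S \<inter> (Y \<inter> (H - K))))"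
    if S: "S \<subseteq> H - K" "S \<noteq> {}" "edges_between S (H - K - S) = 0" for S
  proof -
    have "contacts c S \<ge> int (card (S \<inter> (Y \<inter> (H - K))))"
      using S c fin finite_subset[of S H] by (intro contacts_ge_card) auto
    then show ?thesis
      using connected_host_contract[OF fin connected_host K S] contacts_contract[of c K S] by simp
  qed
  moreover have "private_cuts (H - K) (Y \<inter> (H - K))" by (rule private_cuts_restrict[OF fin p]) auto
  moreover have "\<forall>y\<in>Y \<inter> (H - K). ?c y \<ge> 1" using c by (auto intro: trans_le_add1)
  ultimately obtain k where "star_sequence (H - K) (Y \<inter> (H - K)) k" "4 * int k \<ge> excess (H - K) ?c"
    using part cut_condition_contract[OF cut_condition fin K(1)] unfolding avoids_part_def by blast
  then show ?thesis using that star_sequence_forbid[of "H - K" "Y \<inter> (H - K)" k Y] excess_contract[OF fin K(1), of c]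
    by auto
qed

lemma connected_host_pos: "connected_host H \<Longrightarrow> S \<subseteq> H \<Longrightarrow> S \<noteq> {} \<Longrightarrow> S \<noteq> H \<Longrightarrow> edges_between S (H - S) > 0"
  unfolding connected_host_def by blast

text \<open>Only one piece, with a single contact, is split off at a loss of 2. The rest is joined
  to that piece by a further contact, so \<open>avoids_part\<close> covers it without loss.\<close>

lemma avoids_private_step:
  assumes fin: "finite H" and IH: "\<And>R. R \<subset> H \<Longrightarrow> avoids_vertex R \<and> avoids_part R"
  shows "avoids_private H"
  unfolding avoids_private_def
proof (intro allI impI)
  fix Y :: "'v set"
  let ?c = "\<lambda>v. of_bool (v \<in> Y) :: nat"
  assume connected_host: "connected_host H" and cut_condition: "cut_condition H ?c" and p: "private_cuts H Y"
  show "\<exists>k. star_sequence H Y k \<and> 4 * int k + 2 \<ge> excess H ?c"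
  proof (cases "H = {}")
    case True
    then show ?thesis by (intro exI[of _ 0]) (simp add: excess_def seq_0)
  next
    case False
    have YH: "Y \<subseteq> H" using p by (simp add: private_cuts_def)
    have "contacts ?c H \<ge> 2" using cut_conditionD[OF cut_condition, of H] False by auto
    then have "card Y \<ge> 2" using contacts_of_bool[OF fin, of Y] YH by (simp add: Int_absorb1)
    \<comment> \<open>The second vertex keeps \<open>S\<close>, and later \<open>W\<close>, from
      being all of \<open>H\<close>.\<close>
    then obtain y y' where y: "y \<in> Y" "y' \<in> Y" "y' \<noteq> y"
      by (metis card_2_iff' card_le_Suc0_iff_eq finite_subset[OF YH fin] not_less_eq_eq numeral_2_eq_2)
    obtain S where S: "S \<subseteq> H" "S \<inter> Y = {y}" "edges_between S (H - S) \<le> 1"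
      using p y unfolding private_cuts_def by blast
    have "S \<noteq> {}" using S by blast
    from minimal_cut[OF fin S(1) this S(3)] obtain W where W: "W \<subseteq> S" "W \<noteq> {}" "edges_between W (H - W) \<le> 1"
      "\<And>t. t \<in> W \<Longrightarrow> cut_condition (W - {t}) (m t)" by blast
    have WH: "W \<subseteq> H" "W \<noteq> H" using W S y YH by auto
    have fW: "finite W" using WH fin finite_subset by blast
    have cut: "edges_between W (H - W) = 1" using W(3) connected_host_pos[OF connected_host WH(1) W(2) WH(2)] by linarith
    have "contacts ?c W \<ge> 1" using cut_conditionD[OF cut_condition WH(1) W(2)] cut by simp
    then have "W \<inter> Y \<noteq> {}" using contacts_of_bool[OF fW, of Y] by auto
    moreover have "W \<inter> Y \<subseteq> {y}" using W(1) S(2) by (metis Int_mono order_refl)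
    ultimately have WY: "W \<inter> Y = {y}" by (metis subset_singletonD)
    then have cW: "contacts ?c W = 1" using contacts_of_bool[OF fW, of Y] by simp
    obtain t b where tb: "t \<in> W" "b \<in> H - W" "m t b = 1"
      and z: "\<And>v x. v \<in> W \<Longrightarrow> x \<in> H - W \<Longrightarrow> v \<noteq> t \<or> x \<noteq> b \<Longrightarrow> m v x = 0"
      using edges_between_1D[OF fW finite_Diff[OF fin] cut] by blast
    have "W - {t} \<subset> H" "H - W \<subset> H" using WH W tb by auto
    with IH have IH': "avoids_vertex (W - {t})" "avoids_part (H - W)" by blast+
    obtain j where j: "star_sequence (W - {t}) {y} j" "4 * int j \<ge> excess (W - {t}) (m t)"
      using IH'(1) W(4)[OF tb(1)] unfolding avoids_vertex_def by blast
    obtain k where k: "star_sequence (H - W) Y k" "4 * int k \<ge> excess H ?c - excess W ?c"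
      using avoids_part_contract[OF fin connected_host cut_condition p _ WH(1) W(2) IH'(2)] by auto
    have "star_sequence ((W - {t}) \<union> (H - W)) Y (j + k)"
      by (rule star_sequence_append[OF j(1) _ _ k(1)]) (use z WY in auto)
    then have "star_sequence H Y (j + k)" by (rule star_sequence_mono) (use WH in auto)
    moreover have "4 * int (j + k) + 2 \<ge> excess H ?c"
      using j(2) k(2) excess_remove_root[OF fW tb(1), of ?c] cW by simp
    ultimately show ?thesis by blast
  qed
qed

text \<open>In a connected host, small cuts missing \<open>Y\<close> are split off by
  \<open>leaf_step\<close>. If there are none, the contacts can be thinned out to one for each
  vertex of \<open>Y\<close>; this raises the excess by at least 2 and so covers the loss in
  \<open>avoids_private\<close>.\<close>

lemma avoids_part_step:
  assumes fin: "finite H" and IH: "\<And>R. R \<subset> H \<Longrightarrow> avoids_vertex R \<and> avoids_contacts R \<and> avoids_part R" and "avoids_vertex H" "avoids_private H"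
  shows "avoids_part H"
  unfolding avoids_part_def
proof (intro allI impI)
  fix c Y
  assume cut_condition: "cut_condition H c" and p: "private_cuts H Y" and c: "\<forall>y\<in>Y. c y \<ge> 1"
    and comp: "\<forall>S\<subseteq>H. S \<noteq> {} \<longrightarrow> edges_between S (H - S) = 0 \<longrightarrow> contacts c S > int (card (S \<inter> Y))"
  have YH: "Y \<subseteq> H" using p by (simp add: private_cuts_def)
  show "\<exists>k. star_sequence H Y k \<and> 4 * int k \<ge> excess H c"
  proof (cases "connected_host H")
    case False
    then obtain S where S: "S \<subseteq> H" "S \<noteq> {}" "S \<noteq> H" "edges_between S (H - S) = 0"
      unfolding connected_host_def using edges_between_nonneg by (metis order_le_less)
    have S': "H - S \<subseteq> H" "H - S \<noteq> {}" "H - S \<noteq> H" "edges_between (H - S) (H - (H - S)) = 0"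
      using S edges_between_sym by (auto simp: double_diff)
    have part: "\<exists>k. star_sequence R Y k \<and> 4 * int k \<ge> excess R c"
      if R: "R \<subseteq> H" "R \<noteq> {}" "R \<noteq> H" "edges_between R (H - R) = 0" for R
    proof -
      have "contacts c Q > int (card (Q \<inter> (Y \<inter> R)))" if Q: "Q \<subseteq> R" "Q \<noteq> {}" "edges_between Q (R - Q) = 0" for Q
      proof -
        have "edges_between Q (H - R) \<le> edges_between R (H - R)"
          by (rule edges_between_mono) (use Q R fin finite_subset[of R H] in auto)
        moreover have "edges_between Q (H - Q) = edges_between Q (R - Q) + edges_between Q (H - Q - (R - Q))"
          by (rule edges_between_split_right) (use Q R fin in auto)
        moreover have "H - Q - (R - Q) = H - R" using Q by blast
        ultimately have "edges_between Q (H - Q) = 0" using Q R edges_between_nonneg[of Q "H - R"] by simp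
        then have "contacts c Q > int (card (Q \<inter> Y))" using comp Q R by blast
        moreover have "Q \<inter> (Y \<inter> R) = Q \<inter> Y" using Q by blast
        ultimately show ?thesis by simp
      qed
      moreover have "private_cuts R (Y \<inter> R)" by (rule private_cuts_restrict[OF fin p R(1)])
      moreover have "cut_condition R c" by (rule cut_condition_component[OF cut_condition fin R(1,4)])
      moreover have "avoids_part R" using IH R by blast
      ultimately obtain k where "star_sequence R (Y \<inter> R) k" "4 * int k \<ge> excess R c"
        using c unfolding avoids_part_def by blast
      then show ?thesis using star_sequence_forbid[of R "Y \<inter> R" k Y] by blast
    qed
    obtain j k where j: "star_sequence S Y j" "4 * int j \<ge> excess S c" and k: "star_sequence (H - S) Y k" "4 * int k \<ge> excess (H - S) c"
      using part[OF S] part[OF S'] by blast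
    then have "star_sequence H Y (j + k)" using star_sequence_split[OF fin S(1,4)] by blast
    moreover have "excess H c = excess S c + excess (H - S) c" by (rule cut_condition_component[OF cut_condition fin S(1,4)])
    ultimately show ?thesis using j k by (intro exI[of _ "j + k"]) simp
  next
    case connected_host: True
    have fY: "finite Y" using YH fin finite_subset by blast
    show ?thesis
    proof (cases "card Y \<le> 1")
      case True
      then obtain u where u: "Y \<subseteq> {u}"
        using fY card_le_Suc0_iff_eq[of Y] by (cases "Y = {}") auto
      obtain k where "star_sequence H {u} k" "4 * int k \<ge> excess H c" using \<open>avoids_vertex H\<close> cut_condition unfolding avoids_vertex_def by blast
      then show ?thesis using star_sequence_mono[of H "{u}" k H Y] u by blast
    next
      case cY: False
      then have Yne: "Y \<noteq> {}" by auto
      show ?thesis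
      proof (cases "\<exists>S. S \<subseteq> H - Y \<and> S \<noteq> {} \<and> edges_between S (H - S) \<le> 1")
        case True
        then obtain S where S: "S \<subseteq> H - Y" "S \<noteq> {}" "edges_between S (H - S) \<le> 1" by blast
        have "S \<subseteq> H" using S by blast
        from minimal_cut[OF fin this S(2,3)] obtain W where W: "W \<subseteq> S" "W \<noteq> {}" "edges_between W (H - W) \<le> 1"
          "\<And>t. t \<in> W \<Longrightarrow> cut_condition (W - {t}) (m t)" by blast
        have WH: "W \<subseteq> H" "W \<noteq> H" "Y \<inter> W = {}" using W S Yne YH by auto
        have cut: "edges_between W (H - W) = 1" using W(3) connected_host_pos[OF connected_host WH(1) W(2) WH(2)] by linarith
        have "contacts c W \<ge> 1" using cut_conditionD[OF cut_condition WH(1) W(2)] cut by simp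
        moreover have "avoids_vertex (W - {t}) \<and> avoids_contacts (W - {t})" if "t \<in> W" for t
          using IH[of "W - {t}"] WH that by blast
        ultimately obtain K g where K: "W \<subseteq> K" "K \<subseteq> H" "4 * int g \<ge> excess K c"
          "\<And>U k. U \<inter> W = {} \<Longrightarrow> star_sequence (H - K) U k \<Longrightarrow> star_sequence H U (g + k)"
          using leaf_step[OF fin WH(1) W(4) cut] by metis
        have Kne: "K \<noteq> {}" and "H - K \<subset> H" using K W by blast+
        then have "avoids_part (H - K)" using IH by blast
        then obtain k where k: "star_sequence (H - K) Y k" "4 * int k \<ge> excess H c - excess K c"
          using avoids_part_contract[OF fin connected_host cut_condition p _ K(2) Kne] c by blast
        then have "star_sequence H Y (g + k)" using K(4) WH(3) by blast
        then show ?thesis using K(3) k(2) by (intro exI[of _ "g + k"]) simp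
      next
        case False
        let ?c = "\<lambda>v. of_bool (v \<in> Y) :: nat"
        have "cut_condition H ?c" unfolding cut_condition_def
        proof (intro allI impI)
          fix S assume S: "S \<subseteq> H" "S \<noteq> {}"
          have fS: "finite S" using S fin finite_subset by blast
          have "edges_between S (H - S) \<ge> 2 \<or> card (S \<inter> Y) \<ge> 1"
          proof (cases "S \<inter> Y = {}")
            case True
            then have "S \<subseteq> H - Y" using S by blast
            then have "\<not> edges_between S (H - S) \<le> 1" using False S by blast
            then show ?thesis by linarith
          next
            case False
            then show ?thesis using fS by (simp add: Suc_le_eq card_gt_0_iff)
          qed
          moreover have "card (S \<inter> Y) \<ge> 2" if "edges_between S (H - S) \<le> 0"
          proof -
            have "S = H" using that connected_host_pos[OF connected_host S] by (cases "S = H") auto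
            then show ?thesis using cY YH by (simp add: Int_absorb1)
          qed
          ultimately show "edges_between S (H - S) + contacts ?c S \<ge> 2"
            using contacts_of_bool[OF fS, of Y] edges_between_nonneg[of S "H - S"] by linarith
        qed
        then obtain k where k: "star_sequence H Y k" "4 * int k + 2 \<ge> excess H ?c"
          using \<open>avoids_private H\<close> connected_host p unfolding avoids_private_def by blast
        have "H \<noteq> {}" using YH Yne by blast
        then have "contacts c H > int (card (H \<inter> Y))" using comp by simp
        then have "excess H c + 2 \<le> excess H ?c" using contacts_of_bool[OF fin, of Y] by (simp add: excess_def)
        then show ?thesis using k by auto
      qed
    qed
  qed
qed

section \<open>Avoiding all neighbours of the root\<close>

lemma contacts_decrease:
  assumes "finite S" "c y > 0"
  shows "contacts (c(y := c y - 1)) S = contacts c S - of_bool (y \<in> S)"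
proof (cases "y \<in> S")
  case True
  have "contacts c S = int (c y) + contacts c (S - {y})" "contacts (c(y := c y - 1)) S = int (c y - 1) + contacts (c(y := c y - 1)) (S - {y})"
    using assms True by (simp_all add: contacts_def sum.remove)
  moreover have "contacts (c(y := c y - 1)) (S - {y}) = contacts c (S - {y})" by (rule contacts_cong) auto
  ultimately show ?thesis using assms True by simp
qed (auto intro: contacts_cong)

lemma contacts_le_1D:
  assumes "finite S" "contacts c S \<le> 1" "y \<in> S" "c y > 0"
  shows "c y = 1" "S \<inter> {v. c v > 0} = {y}"
proof -
  have s: "contacts c S = int (c y) + contacts c (S - {y})"
    using assms by (simp add: contacts_def sum.remove)
  then show "c y = 1" using assms(2,4) contacts_nonneg[of c "S - {y}"] by linarith
  then have "contacts c (S - {y}) = 0" using s assms(2) contacts_nonneg[of c "S - {y}"] by linarith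
  then have "\<forall>v\<in>S - {y}. c v = 0"
    using assms unfolding contacts_def by (subst (asm) sum_nonneg_eq_0_iff) auto
  then have "x = y" if "x \<in> S" "c x > 0" for x using that by (cases "x = y") auto
  then show "S \<inter> {v. c v > 0} = {y}" using assms(3,4) by blast
qed

lemma avoids_contacts_step:
  assumes fin: "finite H" and IH: "\<And>R. R \<subset> H \<Longrightarrow> avoids_vertex R \<and> avoids_contacts R" and "avoids_vertex H" "avoids_private H"
  shows "avoids_contacts H"
  unfolding avoids_contacts_def
proof (intro allI impI)
  fix c assume cut_condition: "cut_condition H c" and dvd: "4 dvd excess H c"
  let ?Y = "{v. c v > 0}"
  let ?goal = "(\<exists>k. star_sequence H {} k \<and> 4 * int k \<ge> excess H c + 4) \<or> (\<exists>k. star_sequence H ?Y k \<and> 4 * int k \<ge> excess H c)"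
  consider y where "y \<in> H" "c y > 0" "cut_condition H (c(y := c y - 1))"
    | S where "S \<subseteq> H" "S \<noteq> {}" "S \<noteq> H" "edges_between S (H - S) = 0"
    | "connected_host H" "\<And>y. y \<in> H \<Longrightarrow> c y > 0 \<Longrightarrow> \<not> cut_condition H (c(y := c y - 1))"
    unfolding connected_host_def using edges_between_nonneg by (metis order_le_less)
  then show ?goal
  proof cases
    case (1 y)
    let ?c = "c(y := c y - 1)"
    obtain k where k: "star_sequence H {y} k" "4 * int k \<ge> excess H ?c" using \<open>avoids_vertex H\<close> 1 unfolding avoids_vertex_def by blast
    have "excess H ?c = excess H c + 2" using contacts_decrease[of H c y, OF fin 1(2)] 1 by (simp add: excess_def)
    \<comment> \<open>Removing the contact raises the excess to 2 modulo 4, and rounding adds the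
      other 2.\<close>
    then have "4 * int k \<ge> excess H c + 4" using k(2) dvd by presburger
    moreover have "star_sequence H {} k" using star_sequence_mono[OF k(1)] by blast
    ultimately show ?thesis by blast
  next
    case (2 S)
    note co = cut_condition_component[OF cut_condition fin 2(1,4)]
    have S: "S \<subset> H" "H - S \<subset> H" using 2 by auto
    have fS: "finite S" using S fin finite_subset by blast
    have add: "star_sequence H U (j + k)" if "star_sequence S U j" "star_sequence (H - S) U k" for U j k
      using star_sequence_split[OF fin 2(1,4) that] .
    have b: "\<exists>k. star_sequence R {} k \<and> 4 * int k \<ge> excess R c" if R: "R \<subset> H" "cut_condition R c" for R
    proof -
      have "avoids_vertex R" using IH R(1) by blast
      then obtain k where "star_sequence R {undefined} k" "4 * int k \<ge> excess R c"
        using R(2) unfolding avoids_vertex_def by blast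
      then show ?thesis using star_sequence_mono[of R "{undefined}" k R "{}"] by blast
    qed
    obtain j k where j: "star_sequence S {} j" "4 * int j \<ge> excess S c" and k: "star_sequence (H - S) {} k" "4 * int k \<ge> excess (H - S) c"
      using b[OF S(1) co(1)] b[OF S(2) co(3)] by blast
    show ?thesis
    proof (cases "4 dvd excess S c")
      case False
      have "even (excess S c)" "even (excess (H - S) c)" using excess_even fin fS by auto
      \<comment> \<open>Both parts are 2 modulo 4, so each of them rounds up by 2.\<close>
      then have "4 * int (j + k) \<ge> excess H c + 4" using False dvd co(2) j(2) k(2) by presburger
      then show ?thesis using add[OF j(1) k(1)] by blast
    next
      case True
      then have True': "4 dvd excess (H - S) c" using dvd co(2) by presburger
      consider j' where "star_sequence S {} j'" "4 * int j' \<ge> excess S c + 4"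
        | k' where "star_sequence (H - S) {} k'" "4 * int k' \<ge> excess (H - S) c + 4"
        | j' k' where "star_sequence S ?Y j'" "4 * int j' \<ge> excess S c" "star_sequence (H - S) ?Y k'" "4 * int k' \<ge> excess (H - S) c"
        using IH[OF S(1)] IH[OF S(2)] co(1,3) True True' unfolding avoids_contacts_def by blast
      then show ?thesis
      proof cases
        case (1 j')
        then show ?thesis using add[OF 1(1) k(1)] k(2) co(2) by (intro disjI1 exI[of _ "j' + k"]) simp
      next
        case (2 k')
        then show ?thesis using add[OF j(1) 2(1)] j(2) co(2) by (intro disjI1 exI[of _ "j + k'"]) simp
      next
        case (3 j' k')
        then show ?thesis using add[OF 3(1,3)] co(2) by (intro disjI2 exI[of _ "j' + k'"]) simp
      qed
    qed
  next
    case 3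
    \<comment> \<open>Lowering \<open>c y\<close> breaks the bound at some \<open>S\<close>; this
      set must contain \<open>y\<close> and attain the value 2.\<close>
    have tight: "\<exists>S\<subseteq>H. y \<in> S \<and> edges_between S (H - S) + contacts c S = 2" if y: "y \<in> H" "c y > 0" for y
    proof -
      obtain S where S: "S \<subseteq> H" "S \<noteq> {}" "edges_between S (H - S) + contacts (c(y := c y - 1)) S < 2"
        using 3(2)[OF y] unfolding cut_condition_def by (meson not_le)
      have "edges_between S (H - S) + contacts c S \<ge> 2" using S cut_condition unfolding cut_condition_def by blast
      moreover have "contacts (c(y := c y - 1)) S = contacts c S - of_bool (y \<in> S)"
        using contacts_decrease[of S c y] y(2) S fin finite_subset by blast
      ultimately show ?thesis using S by (intro exI[of _ S]) (auto simp: of_bool_def split: if_splits)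
    qed
    show ?thesis
    proof (cases "\<exists>y\<in>H. c y > 0 \<and> contacts c H = 2 \<and> (\<forall>S\<subseteq>H - {y}. S \<noteq> {} \<longrightarrow> edges_between S (H - S) \<ge> 2)")
      case True
      then obtain y where y: "y \<in> H" "c y > 0" "contacts c H = 2"
        and S: "\<And>S. S \<subseteq> H - {y} \<Longrightarrow> S \<noteq> {} \<Longrightarrow> edges_between S (H - S) \<ge> 2" by blast
      \<comment> \<open>With \<open>y\<close> as root only one further vertex has to be avoided,
        since three vertices would carry three contacts.\<close>
      have "\<exists>u. (H - {y}) \<inter> ?Y \<subseteq> {u}"
      proof (rule ccontr)
        assume n: "\<not> ?thesis"
        then obtain u where u: "u \<in> (H - {y}) \<inter> ?Y" by blast
        obtain v where v: "v \<in> (H - {y}) \<inter> ?Y" "v \<noteq> u" using n by blast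
        have d: "y \<noteq> u" "y \<noteq> v" "u \<noteq> v" using u v by auto
        have "contacts c {y, u, v} \<le> contacts c H"
          unfolding contacts_def by (rule sum_mono2) (use u v y fin in auto)
        then have "int (c y) + (int (c u) + int (c v)) \<le> contacts c H"
          using d by (simp add: contacts_def[of c "{y, u, v}"])
        then show False using u v y by auto
      qed
      then obtain u where u: "(H - {y}) \<inter> ?Y \<subseteq> {u}" by blast
      have "H - {y} \<subset> H" using y by blast
      then obtain k where k: "star_sequence (H - {y}) {u} k" "4 * int k \<ge> excess (H - {y}) (m y)"
        using IH cut_condition_root[OF fin y(1) S] unfolding avoids_vertex_def by blast
      have "star_sequence H ?Y k" using star_sequence_mono[OF star_sequence_forbid[OF k(1) u]] by blast
      moreover have "4 * int k \<ge> excess H c" using k(2) excess_remove_root[OF fin y(1), of c] y(3) by simp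
      ultimately show ?thesis by blast
    next
      case False
      let ?Z = "H \<inter> ?Y" and ?c = "\<lambda>v. of_bool (v \<in> H \<inter> {v. c v > 0}) :: nat"
      have pr: "c y = 1 \<and> (\<exists>S\<subseteq>H. S \<inter> ?Z = {y} \<and> edges_between S (H - S) \<le> 1)" if y: "y \<in> H" "c y > 0" for y
      proof -
        have "\<exists>S\<subseteq>H. y \<in> S \<and> contacts c S \<le> 1 \<and> edges_between S (H - S) \<le> 1"
        proof -
          obtain S where S: "S \<subseteq> H" "y \<in> S" "edges_between S (H - S) + contacts c S = 2" using tight[OF y] by blast
          have "contacts c S \<ge> 1" using contacts_ge[of S y c] S fin finite_subset[of S H] y by auto
          then consider "contacts c S \<le> 1" "edges_between S (H - S) \<le> 1" | "edges_between S (H - S) = 0" using S(3) edges_between_nonneg[of S "H - S"] by linarith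
          then show ?thesis
          proof cases
            case 1
            then show ?thesis using S by blast
          next
            case 2
            then have SH: "S = H" using connected_host_pos[OF 3(1) S(1)] S(2) by (cases "S = H") auto
            then have "contacts c H = 2" using S(3) 2 by simp
            \<comment> \<open>A small cut \<open>R\<close> missing \<open>y\<close> takes at least
              one of the two contacts. Its complement contains \<open>y\<close>, has the same
              boundary and retains at most one contact.\<close>
            then have "\<not> (\<forall>R\<subseteq>H - {y}. R \<noteq> {} \<longrightarrow> edges_between R (H - R) \<ge> 2)" using False y by blast
            then obtain R where R: "R \<subseteq> H - {y}" "R \<noteq> {}" "edges_between R (H - R) < 2" by (meson not_le)
            have RH: "R \<subseteq> H" "H - (H - R) = R" using R by auto
            have "contacts c R \<ge> 1" using cut_conditionD[OF cut_condition RH(1) R(2)] R(3) by linarith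
            then have "contacts c (H - R) \<le> 1" using contacts_split[OF fin RH(1), of c] \<open>contacts c H = 2\<close> by simp
            moreover have "edges_between (H - R) (H - (H - R)) \<le> 1" using R RH edges_between_sym[of R] by simp
            ultimately show ?thesis using R y by (intro exI[of _ "H - R"]) auto
          qed
        qed
        then obtain S where S: "S \<subseteq> H" "y \<in> S" "contacts c S \<le> 1" "edges_between S (H - S) \<le> 1" by blast
        have "finite S" using S fin finite_subset by blast
        note c1 = contacts_le_1D[OF this S(3,2) y(2)]
        have "S \<inter> ?Z = {y}" using c1(2) S(1) by blast
        then show ?thesis using c1(1) S by blast
      qed
      have eq: "?c v = c v" if "v \<in> H" for v using pr[OF that] that by (cases "c v > 0") auto
      then have cc: "contacts ?c S = contacts c S" if "S \<subseteq> H" for S using that by (intro contacts_cong) blast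
      have "cut_condition H ?c" using cut_condition cc unfolding cut_condition_def by simp
      moreover have "private_cuts H ?Z" using pr unfolding private_cuts_def by blast
      ultimately obtain k where k: "star_sequence H ?Z k" "4 * int k + 2 \<ge> excess H ?c"
        using \<open>avoids_private H\<close> 3(1) unfolding avoids_private_def by blast
      have "excess H ?c = excess H c" using cc[of H] by (simp add: excess_def)
      \<comment> \<open>Divisibility by 4 absorbs the loss of 2.\<close>
      then have "4 * int k \<ge> excess H c" using k(2) dvd by presburger
      moreover have "star_sequence H ?Y k" using star_sequence_forbid[OF k(1)] by blast
      ultimately show ?thesis by blast
    qed
  qed
qed

text \<open>\<open>avoids_private\<close> at \<open>H\<close> rests on smaller sets only, while
  \<open>avoids_part\<close> and \<open>avoids_contacts\<close> use it at \<open>H\<close> itself;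
  it is therefore derived within the step.\<close>

lemma avoidance_bounds: "finite H \<Longrightarrow> avoids_vertex H \<and> avoids_contacts H \<and> avoids_part H"
proof (induction H rule: finite_psubset_induct)
  case (psubset H)
  have b: "avoids_vertex H" by (rule avoids_vertex_step) (use psubset in blast)+
  have d: "avoids_private H" by (rule avoids_private_step) (use psubset in blast)+
  have "avoids_part H" by (rule avoids_part_step) (use psubset b d in blast)+
  moreover have "avoids_contacts H" by (rule avoids_contacts_step) (use psubset b d in blast)+
  ultimately show ?case using b by blast
qed

lemma star_sequence_exists:
  assumes "finite V" "V \<noteq> {}" "\<And>S. S \<subseteq> V \<Longrightarrow> S \<noteq> {} \<Longrightarrow> S \<noteq> V \<Longrightarrow> edges_between S (V - S) \<ge> 2"
  shows "\<exists>k. star_sequence V {} k \<and> 4 * int k \<ge> 4 * int (card V) - 4 - edges_between V V"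
proof -
  obtain x where x: "x \<in> V" using assms by blast
  have "cut_condition (V - {x}) (m x)"
    by (rule cut_condition_root) (use assms x in auto)
  then obtain k where k: "star_sequence (V - {x}) {x} k" "4 * int k \<ge> excess (V - {x}) (m x)"
    using avoidance_bounds[of "V - {x}"] assms unfolding avoids_vertex_def by blast
  have "4 * int k \<ge> 4 * int (card V) - 4 - edges_between V V"
    using k(2) excess_remove_root[OF assms(1) x, of "\<lambda>_. 0"] by (simp add: excess_def contacts_def)
  then show ?thesis using star_sequence_mono[OF k(1)] by blast
qed

end

section \<open>From star sequences to independent edges\<close>

definition edge_count :: "('v, 'e) mgraph \<Rightarrow> 'v \<Rightarrow> 'v \<Rightarrow> nat" where
  "edge_count G a b = (if a = b then 0 else card {e \<in> edges G. ends G e = {a, b}})"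

lemma multiplicity_function_edge_count: "multiplicity_function (edge_count G)"
  by unfold_locales (auto simp: edge_count_def insert_commute)

text \<open>Collapsing the star of \<open>v\<close> changes multiplicities only at \<open>v\<close>,
  which has left the host. So \<open>m\<close> has to agree with \<open>G\<close> on
  \<open>A\<close> alone, and \<open>G\<close> varies along the induction. Keeping the ends inside
  the host allows singularity and nonadjacency to be pulled back from the quotient.\<close>

lemma (in multiplicity_function) star_sequence_imp_indep_edges:
  fixes G :: "('v, 'e) mgraph"
  assumes "star_sequence A U k" and "finite (edges G)"
    and "\<And>e. e \<in> edges G \<Longrightarrow> finite (ends G e) \<and> card (ends G e) \<le> 2"
    and "\<And>a b. a \<in> A \<Longrightarrow> b \<in> A \<Longrightarrow> a \<noteq> b \<Longrightarrow> m a b = card {e \<in> edges G. ends G e = {a, b}}"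
  shows "\<exists>F. indep_edges G F \<and> F \<subseteq> edges G \<and> card F = k \<and> (\<forall>e\<in>F. singular G e \<and> ends G e \<subseteq> A)
    \<and> (\<forall>e\<in>F. \<forall>f\<in>F. \<not> adjacent G e f)"
  using assms
proof (induction arbitrary: G rule: star_sequence.induct)
  case (seq_0 H U)
  show ?case by (intro exI[of _ "{}"]) (simp add: indep_edges.empty)
next
  case (seq_Suc v A U w k)
  let ?S = "star G v" and ?A = "{x \<in> A. x \<noteq> v \<and> m v x = 0}"
  let ?G = "quotient_by G ?S v"
  define q where "q = (\<lambda>u. if u \<in> verts ?S then v else u)"
  have fin: "finite (edges G)"
    and two: "\<And>e. e \<in> edges G \<Longrightarrow> finite (ends G e) \<and> card (ends G e) \<le> 2"
    and count: "\<And>a b. a \<in> A \<Longrightarrow> b \<in> A \<Longrightarrow> a \<noteq> b \<Longrightarrow> m a b = card {e \<in> edges G. ends G e = {a, b}}"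
    using seq_Suc.prems by auto
  have G': "edges ?G = {e \<in> edges G. v \<notin> ends G e}" "ends ?G e = q ` ends G e" for e
    by (auto simp: quotient_by_def star_def q_def Let_def)
  have S: "verts ?S = (\<Union>e\<in>{e \<in> edges G. v \<in> ends G e}. ends G e)"
    by (simp add: star_def Let_def)
  have ends2: "ends G e = {a, b}" if "e \<in> edges G" "a \<in> ends G e" "b \<in> ends G e" "a \<noteq> b" for e a b
  proof -
    have "finite (ends G e)" "card (ends G e) \<le> card {a, b}" using two[OF that(1)] that(4) by auto
    moreover have "{a, b} \<subseteq> ends G e" using that by blast
    ultimately have "{a, b} = ends G e" by (intro card_seteq)
    then show ?thesis by simp
  qed
  have notin: "x \<notin> verts ?S" if "x \<in> ?A" for x
  proof
    assume "x \<in> verts ?S"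
    then obtain e where "e \<in> edges G" "v \<in> ends G e" "x \<in> ends G e" unfolding S by blast
    then have "e \<in> {e \<in> edges G. ends G e = {v, x}}" using ends2[of e v x] that by auto
    then have "card {e \<in> edges G. ends G e = {v, x}} > 0" using fin by (auto simp: card_gt_0_iff)
    then show False using count[of v x] that seq_Suc.hyps by auto
  qed
  \<comment> \<open>Every vertex that \<open>q\<close> moves goes to \<open>v\<close>, which is not
    in \<open>?A\<close>.\<close>
  have img_id: "q ` X = X" if "q ` X \<subseteq> ?A" for X
  proof -
    have "q x = x" if "x \<in> X" for x
      using that \<open>q ` X \<subseteq> ?A\<close> by (force simp: q_def)
    then show ?thesis by force
  qed
  have img_id': "q ` X = X" if "X \<subseteq> ?A" for X
  proof -
    have "q x = x" if "x \<in> X" for x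
      using that \<open>X \<subseteq> ?A\<close> notin[of x] by (auto simp: q_def)
    then show ?thesis by force
  qed
  have same: "e \<in> edges ?G \<and> ends ?G e = ends G e"
    if "e \<in> edges G" "ends G e \<subseteq> ?A" for e
    using that img_id'[OF that(2)] by (auto simp: G')
  have "\<exists>F. indep_edges ?G F \<and> F \<subseteq> edges ?G \<and> card F = k \<and> (\<forall>e\<in>F. singular ?G e \<and> ends ?G e \<subseteq> ?A)
    \<and> (\<forall>e\<in>F. \<forall>f\<in>F. \<not> adjacent ?G e f)"
  proof (rule seq_Suc.IH)
    show "finite (edges ?G)" using fin by (simp add: G')
    show "finite (ends ?G e) \<and> card (ends ?G e) \<le> 2" if "e \<in> edges ?G" for e
    proof -
      have "e \<in> edges G" using that by (simp add: G')
      then show ?thesis using two[of e] card_image_le[of "ends G e" q] by (auto simp: G')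
    qed
    show "m a b = card {e \<in> edges ?G. ends ?G e = {a, b}}" if ab: "a \<in> ?A" "b \<in> ?A" "a \<noteq> b" for a b
    proof -
      have "{e \<in> edges ?G. ends ?G e = {a, b}} = {e \<in> edges G. ends G e = {a, b}}"
      proof (intro equalityI subsetI)
        fix e assume e: "e \<in> {e \<in> edges ?G. ends ?G e = {a, b}}"
        then have "q ` ends G e \<subseteq> ?A" using ab by (auto simp: G')
        then show "e \<in> {e \<in> edges G. ends G e = {a, b}}" using e img_id[of "ends G e"] by (auto simp: G')
      next
        fix e assume "e \<in> {e \<in> edges G. ends G e = {a, b}}"
        then show "e \<in> {e \<in> edges ?G. ends ?G e = {a, b}}" using same[of e] ab by auto
      qed
      then show ?thesis using count[of a b] ab by simp
    qed
  qed
  then obtain F where F: "indep_edges ?G F" "F \<subseteq> edges ?G" "card F = k"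
    "\<And>e. e \<in> F \<Longrightarrow> singular ?G e" "\<And>e. e \<in> F \<Longrightarrow> ends ?G e \<subseteq> ?A"
    "\<And>e f. e \<in> F \<Longrightarrow> f \<in> F \<Longrightarrow> \<not> adjacent ?G e f" by blast
  have endsF: "ends ?G e = ends G e" "ends G e \<subseteq> ?A" "e \<in> edges G" if "e \<in> F" for e
    using F(5)[OF that] img_id[of "ends G e"] F(2) that by (auto simp: G')
  have "v \<noteq> w" using seq_Suc.hyps by auto
  then have "card {e \<in> edges G. ends G e = {v, w}} = 1" using count[of v w] seq_Suc.hyps by simp
  then obtain e0 where e0: "{e \<in> edges G. ends G e = {v, w}} = {e0}" by (auto simp: card_1_singleton_iff)
  then have e0': "e0 \<in> edges G" "ends G e0 = {v, w}" by auto
  have disj: "ends G e \<inter> {v, w} = {}" if "e \<in> F" for e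
    using endsF(2)[OF that] seq_Suc.hyps by auto
  then have "e0 \<notin> F" using e0' by auto
  have sing0: "singular G e0" using e0 e0' unfolding singular_def by blast
  have sing: "singular G e" if "e \<in> F" for e
    unfolding singular_def
  proof (intro conjI ballI impI)
    show "e \<in> edges G" using endsF that by blast
    fix f assume f: "f \<in> edges G" "ends G f = ends G e"
    then have "f \<in> edges ?G" "ends ?G f = ends ?G e" using same[of f] endsF[OF that] by auto
    then show "f = e" using F(4)[OF that] unfolding singular_def by blast
  qed
  have adj: "\<not> adjacent G e f" if "e \<in> insert e0 F" "f \<in> insert e0 F" for e f
  proof -
    have "\<not> adjacent G e f" if "e \<in> F" "f \<in> F"
      using F(6)[OF that] endsF[OF that(1)] endsF[OF that(2)] by (simp add: adjacent_def)
    moreover have "\<not> adjacent G e0 f \<and> \<not> adjacent G f e0" if "f \<in> F" for f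
      using disj[OF that] e0' by (auto simp: adjacent_def)
    ultimately show ?thesis using that by (auto simp: adjacent_def)
  qed
  have "indep_edges G (insert e0 F)"
  proof (rule indep_edges.step)
    show "\<forall>e\<in>insert e0 F. singular G e" using sing sing0 by blast
    show "\<forall>e\<in>insert e0 F. \<forall>f\<in>insert e0 F. \<not> adjacent G e f" using adj by blast
    show "e0 \<in> insert e0 F" "v \<in> ends G e0" using e0'(2) by auto
    show "indep_edges ?G (insert e0 F - {e0})" using F(1) \<open>e0 \<notin> F\<close> by simp
  qed
  moreover have "ends G e \<subseteq> A" if "e \<in> F" for e using endsF(2)[OF that] by blast
  moreover have FE: "F \<subseteq> edges G" using endsF by blast
  moreover have "finite F" using FE fin by (rule finite_subset)
  ultimately show ?case
    using \<open>e0 \<notin> F\<close> F(3) sing sing0 adj e0' seq_Suc.hyps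
    by (intro exI[of _ "insert e0 F"]) auto
qed

text \<open>The maximum is over a finite set, since independent edges are singular and hence edges
  of \<open>G\<close>.\<close>

lemma card_le_graph_index:
  assumes "finite (edges G)" "indep_edges G F"
  shows "card F \<le> graph_index G"
proof -
  have sub: "F \<subseteq> edges G" if "indep_edges G F" for F
    using that by cases (auto simp: singular_def)
  have "{card F |F. indep_edges G F} \<subseteq> {..card (edges G)}"
    using sub card_mono[OF assms(1)] by auto
  then have "finite {card F |F. indep_edges G F}" using finite_subset by blast
  then show ?thesis unfolding graph_index_def using assms(2) by (intro Max_ge) auto
qed

text \<open>In \<open>edges_between\<close> of all vertices with themselves, each edge counts at
  most twice, once for each order of its ends. Halving the resulting estimate 4k \<ge> 4V - 4 - 2E
  gives the bound.\<close>

lemma edges_ge_index: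
  assumes fV: "finite (verts G)" and fE: "finite (edges G)"
    and ends: "\<And>e. e \<in> edges G \<Longrightarrow> ends G e \<subseteq> verts G \<and> card (ends G e) \<le> 2"
    and cut: "\<And>S. S \<subseteq> verts G \<Longrightarrow> S \<noteq> {} \<Longrightarrow> S \<noteq> verts G \<Longrightarrow>
      card {e \<in> edges G. ends G e \<inter> S \<noteq> {} \<and> ends G e - S \<noteq> {}} \<ge> 2"
  shows "2 * card (verts G) \<le> card (edges G) + 2 * graph_index G + 2"
proof (cases "verts G = {}")
  case False
  let ?V = "verts G"
  interpret multiplicity_function "edge_count G" by (rule multiplicity_function_edge_count)
  have swap: "edges_between A B = (\<Sum>e\<in>edges G. \<Sum>a\<in>A. \<Sum>b\<in>B. of_bool (a \<noteq> b \<and> ends G e = {a, b}))" for A B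
  proof -
    have "int (edge_count G a b) = (\<Sum>e\<in>edges G. of_bool (a \<noteq> b \<and> ends G e = {a, b}))" for a b
      using fE by (simp add: edge_count_def sum_of_bool_eq Int_def)
    then have "edges_between A B = (\<Sum>a\<in>A. \<Sum>e\<in>edges G. \<Sum>b\<in>B. of_bool (a \<noteq> b \<and> ends G e = {a, b}))"
      unfolding edges_between_def using sum.swap by (intro sum.cong) auto
    also have "\<dots> = (\<Sum>e\<in>edges G. \<Sum>a\<in>A. \<Sum>b\<in>B. of_bool (a \<noteq> b \<and> ends G e = {a, b}))"
      by (rule sum.swap)
    finally show ?thesis .
  qed
  have "edges_between S (?V - S) \<ge> 2" if S: "S \<subseteq> ?V" "S \<noteq> {}" "S \<noteq> ?V" for S
  proof -
    let ?C = "{e \<in> edges G. ends G e \<inter> S \<noteq> {} \<and> ends G e - S \<noteq> {}}"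
    have fS: "finite S" using S fV finite_subset by blast
    have "int (card ?C) = (\<Sum>e\<in>edges G. of_bool (ends G e \<inter> S \<noteq> {} \<and> ends G e - S \<noteq> {}))"
      using fE by (simp add: sum_of_bool_eq Int_def)
    also have "\<dots> \<le> edges_between S (?V - S)" unfolding swap
    proof (rule sum_mono)
      fix e assume e: "e \<in> edges G"
      show "of_bool (ends G e \<inter> S \<noteq> {} \<and> ends G e - S \<noteq> {}) \<le>
        (\<Sum>a\<in>S. \<Sum>b\<in>?V - S. of_bool (a \<noteq> b \<and> ends G e = {a, b}) :: int)"
      proof (cases "ends G e \<inter> S \<noteq> {} \<and> ends G e - S \<noteq> {}")
        case True
        then obtain a b where ab: "a \<in> ends G e" "a \<in> S" "b \<in> ends G e" "b \<notin> S" by blast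
        then have b: "b \<in> ?V - S" and "a \<noteq> b" using ends[OF e] by auto
        have "{a, b} = ends G e"
        proof (rule card_seteq)
          show "finite (ends G e)" using ends[OF e] fV finite_subset by blast
          show "card (ends G e) \<le> card {a, b}" using ends[OF e] \<open>a \<noteq> b\<close> by auto
        qed (use ab in auto)
        then have "1 = (of_bool (a \<noteq> b \<and> ends G e = {a, b}) :: int)" using \<open>a \<noteq> b\<close> by simp
        also have "\<dots> \<le> (\<Sum>b\<in>?V - S. of_bool (a \<noteq> b \<and> ends G e = {a, b}))"
          using b fV by (intro member_le_sum) auto
        also have "\<dots> \<le> (\<Sum>a\<in>S. \<Sum>b\<in>?V - S. of_bool (a \<noteq> b \<and> ends G e = {a, b}))"
          using ab fS by (intro member_le_sum[of a S "\<lambda>a. \<Sum>b\<in>?V - S. of_bool (a \<noteq> b \<and> ends G e = {a, b})"])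
            (auto intro: sum_nonneg)
        finally show ?thesis using True by simp
      qed (auto intro!: sum_nonneg)
    qed
    finally show ?thesis using cut[OF S] by simp
  qed
  then obtain k where k: "star_sequence ?V {} k" "4 * int k \<ge> 4 * int (card ?V) - 4 - edges_between ?V ?V"
    using star_sequence_exists[OF fV False] by blast
  have "edges_between ?V ?V \<le> (\<Sum>e\<in>edges G. 2)" unfolding swap
  proof (rule sum_mono)
    fix e
    let ?P = "{p \<in> ?V \<times> ?V. fst p \<noteq> snd p \<and> ends G e = {fst p, snd p}}"
    have "(\<Sum>a\<in>?V. \<Sum>b\<in>?V. of_bool (a \<noteq> b \<and> ends G e = {a, b}) :: int) = int (card ?P)"
    proof -
      have "(\<Sum>a\<in>?V. \<Sum>b\<in>?V. of_bool (a \<noteq> b \<and> ends G e = {a, b}) :: int) =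
          (\<Sum>p\<in>?V \<times> ?V. of_bool (fst p \<noteq> snd p \<and> ends G e = {fst p, snd p}))"
        by (simp only: sum.cartesian_product case_prod_unfold)
      also have "\<dots> = int (card (?V \<times> ?V \<inter> {p. fst p \<noteq> snd p \<and> ends G e = {fst p, snd p}}))"
        using fV by (intro sum_of_bool_eq finite_cartesian_product)
      finally show ?thesis by (simp add: Int_def)
    qed
    also have "card ?P \<le> 2"
    proof (cases "?P = {}")
      case False
      then obtain p where p: "p \<in> ?P" by blast
      have "?P \<subseteq> {p, prod.swap p}" using p by (auto simp: doubleton_eq_iff)
      then have "card ?P \<le> card {p, prod.swap p}" by (rule card_mono[rotated]) auto
      also have "\<dots> \<le> 2" by (simp add: card_insert_if)
      finally show ?thesis .
    next
      case True
      then show ?thesis by (metis card.empty zero_le)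
    qed
    finally show "(\<Sum>a\<in>?V. \<Sum>b\<in>?V. of_bool (a \<noteq> b \<and> ends G e = {a, b}) :: int) \<le> 2" by simp
  qed
  then have 1: "edges_between ?V ?V \<le> 2 * int (card (edges G))" by simp
  have "\<exists>F. indep_edges G F \<and> F \<subseteq> edges G \<and> card F = k \<and> (\<forall>e\<in>F. singular G e \<and> ends G e \<subseteq> ?V)
    \<and> (\<forall>e\<in>F. \<forall>f\<in>F. \<not> adjacent G e f)"
  proof (rule star_sequence_imp_indep_edges[OF k(1) fE])
    show "finite (ends G e) \<and> card (ends G e) \<le> 2" if "e \<in> edges G" for e
      using ends[OF that] fV finite_subset by blast
  qed (simp add: edge_count_def)
  then have "k \<le> graph_index G" using card_le_graph_index[OF fE] by blast
  then show ?thesis using k(2) 1 by linarith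
qed simp

section \<open>Smoothings of a generic diagram\<close>

locale generic_diagram =
  fixes D :: "'t diagram"
  assumes generic: "generic_immersion D"
begin

abbreviation "r \<equiv> radius D"

section \<open>The discs around the crossings\<close>

lemma radius_pos: "r > 0"
  and balls_disjoint: "c \<in> crossings D \<Longrightarrow> c' \<in> crossings D \<Longrightarrow> c \<noteq> c' \<Longrightarrow> cball c r \<inter> cball c' r = {}"
  and not_in_ball: "i < ncircles D \<Longrightarrow> c \<in> crossings D \<Longrightarrow> \<not> range (curve D i) \<subseteq> ball c r"
  and disc_strands: "c \<in> crossings D \<Longrightarrow> dimage D \<inter> cball c r = (\<Union>p \<in> passes D c. strand D r p)"
proof -
  note sr = smoothing_radius_radius[OF generic, unfolded smoothing_radius_def]
  note sr2 = conjunct2[OF sr] note sr3 = conjunct2[OF sr2] note sr4 = conjunct2[OF sr3]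
  show "r > 0" using sr by (rule conjunct1)
  show "cball c r \<inter> cball c' r = {}" if "c \<in> crossings D" "c' \<in> crossings D" "c \<noteq> c'"
    using conjunct1[OF sr2] that by (metis (no_types))
  show "\<not> range (curve D i) \<subseteq> ball c r" if "i < ncircles D" "c \<in> crossings D"
    using conjunct1[OF sr3] that by (metis (no_types))
  show "dimage D \<inter> cball c r = (\<Union>p \<in> passes D c. strand D r p)" if "c \<in> crossings D"
    using conjunct1[OF sr4] that by (metis (no_types))
qed

lemma finite_crossings: "finite (crossings D)"
  by (rule generic_immersionD(5)[OF generic])

lemma passes_crossing:
  assumes "c \<in> crossings D"
  obtains p q where "passes D c = {p, q}" "p \<noteq> q"
  using generic_immersionD(6)[OF generic assms] by (auto simp: card_2_iff)

lemma compact_dimage: "compact (dimage D)"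
proof -
  have "range (curve D i) = curve D i ` {0..1}" if i: "i < ncircles D" for i
  proof -
    have "curve D i t \<in> curve D i ` {0..1}" for t
    proof -
      have "curve D i (frac t) = curve D i t"
        using curve_periodic_int[OF generic i, of t "- \<lfloor>t\<rfloor>"] by (simp add: frac_def)
      moreover have "frac t \<in> {0..1}" by (simp add: frac_lt_1 less_imp_le)
      ultimately show ?thesis by (metis imageI)
    qed
    then show ?thesis by blast
  qed
  moreover have "continuous_on A (curve D i)" if "i < ncircles D" for A i
    using generic_immersionD(2)[OF generic that]
    by (meson continuous_at_imp_continuous_on has_vector_derivative_continuous)
  ultimately show ?thesis unfolding dimage_def by (auto intro!: compact_UN compact_continuous_image)
qed

lemma strand_times:
  assumes c: "c \<in> crossings D" and p: "(i, s) \<in> passes D c"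
  defines "a \<equiv> entry_time D r (i, s)" and "b \<equiv> exit_time D r (i, s)"
  shows "a \<le> s" "s \<le> b" "\<And>t. a < t \<Longrightarrow> t < b \<Longrightarrow> curve D i t \<in> ball c r"
proof -
  have i: "i < ncircles D" and cs: "curve D i s = c" using p by (auto simp: passes_def)
  obtain t0 where t0: "curve D i t0 \<notin> ball c r" using not_in_ball[OF i c] by blast
  let ?L = "{t. t < s \<and> curve D i t \<notin> ball c r}" and ?R = "{t. s < t \<and> curve D i t \<notin> ball c r}"
  have a: "a = Sup ?L" and b: "b = Inf ?R" by (simp_all add: a_def b_def entry_time_def exit_time_def cs)
  \<comment> \<open>By periodicity the curve is outside the disc at arbitrarily early and late
    times, so neither \<open>Sup\<close> nor \<open>Inf\<close> is taken over the empty set.\<close>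
  have "\<exists>k. t0 + of_int k < s" using ex_of_int_less[of "s - t0"] by (auto simp: algebra_simps)
  then have L: "?L \<noteq> {}" using curve_periodic_int[OF generic i, of t0] t0 by auto
  have "\<exists>k. s < t0 + of_int k" using ex_less_of_int[of "s - t0"] by (auto simp: algebra_simps)
  then have R: "?R \<noteq> {}" using curve_periodic_int[OF generic i, of t0] t0 by auto
  show "a \<le> s" unfolding a by (rule cSup_least[OF L]) auto
  show "s \<le> b" unfolding b by (rule cInf_greatest[OF R]) auto
  show "curve D i t \<in> ball c r" if t: "a < t" "t < b" for t
  proof (rule ccontr)
    assume n: "curve D i t \<notin> ball c r"
    then have "t \<noteq> s" using cs radius_pos by auto
    then consider "t < s" | "s < t" by linarith
    then show False
    proof cases
      case 1
      then have "t \<le> a" unfolding a using n by (intro cSup_upper bdd_aboveI[of _ s]) auto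
      then show False using t by simp
    next
      case 2
      then have "b \<le> t" unfolding b using n by (intro cInf_lower bdd_belowI[of _ s]) auto
      then show False using t by simp
    qed
  qed
qed

text \<open>Strictly between entry and exit a strand stays in the open disc, so it can meet the
  bounding circle only at these two times.\<close>

lemma chord_ends:
  assumes c: "c \<in> crossings D" and p: "p \<in> passes D c"
  shows "curve D (fst p) (entry_time D r p) \<in> strand D r p"
    and "curve D (fst p) (exit_time D r p) \<in> strand D r p"
    and "c \<in> strand D r p"
    and "strand D r p \<subseteq> dimage D \<inter> cball c r"
    and "z \<in> strand D r p \<Longrightarrow> z \<notin> ball c r \<Longrightarrow>
      z = curve D (fst p) (entry_time D r p) \<or> z = curve D (fst p) (exit_time D r p)"
proof -
  obtain i s where ps: "p = (i, s)" by (cases p)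
  note t = strand_times[OF c p[unfolded ps], folded ps]
  have cs: "curve D i s = c" using p ps by (auto simp: passes_def)
  show "curve D (fst p) (entry_time D r p) \<in> strand D r p"
    "curve D (fst p) (exit_time D r p) \<in> strand D r p" "c \<in> strand D r p"
    using t cs unfolding strand_def ps by (auto intro!: image_eqI[of _ _ s])
  show "strand D r p \<subseteq> dimage D \<inter> cball c r" unfolding disc_strands[OF c] using p by blast
  assume "z \<in> strand D r p" "z \<notin> ball c r"
  then obtain u where u: "z = curve D i u" "entry_time D r p \<le> u" "u \<le> exit_time D r p"
    unfolding strand_def ps by auto
  then have "\<not> (entry_time D r p < u \<and> u < exit_time D r p)"
    using t(3)[of u] \<open>z \<notin> ball c r\<close> by blast
  then have "u = entry_time D r p \<or> u = exit_time D r p" using u by linarith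
  then show "z = curve D (fst p) (entry_time D r p) \<or> z = curve D (fst p) (exit_time D r p)"
    using u ps by auto
qed

lemma new_arcs_passes:
  assumes "passes D c = {p, q}" "p \<noteq> q"
  shows "new_arcs D c = {chord D r p q, chord D r q p}"
proof -
  have "(\<exists>p' q'. x = chord D r p' q' \<and> p' \<in> {p, q} \<and> q' \<in> {p, q} \<and> p' \<noteq> q') \<longleftrightarrow>
      x = chord D r p q \<or> x = chord D r q p" for x
    using assms(2) by (metis insert_iff singletonD)
  then show ?thesis unfolding new_arcs_def assms(1) by (intro set_eqI) (simp only: mem_Collect_eq insert_iff empty_iff simp_thms)
qed

text \<open>The last property is the gluing condition: where the diagram meets the bounding circle,
  it meets an end point of a new arc.\<close>

lemma new_arcs:
  assumes c: "c \<in> crossings D"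
  shows "finite (new_arcs D c)" "new_arcs D c \<noteq> {}" "card (new_arcs D c) \<le> 2"
    and "\<And>a. a \<in> new_arcs D c \<Longrightarrow> connected a \<and> compact a \<and> a \<noteq> {}"
    and "\<Union>(new_arcs D c) \<subseteq> cball c r"
    and "dimage D \<inter> cball c r - ball c r \<subseteq> \<Union>(new_arcs D c)"
proof -
  obtain p q where pq: "passes D c = {p, q}" "p \<noteq> q" using passes_crossing[OF c] .
  note na = new_arcs_passes[OF pq]
  show "finite (new_arcs D c)" "new_arcs D c \<noteq> {}" "card (new_arcs D c) \<le> 2"
    unfolding na by (auto simp: card_insert_if)
  show "connected a \<and> compact a \<and> a \<noteq> {}" if "a \<in> new_arcs D c" for a
    using that unfolding na chord_def by auto
  have p: "p \<in> passes D c" and q: "q \<in> passes D c" using pq by auto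
  note P = chord_ends[OF c p] and Q = chord_ends[OF c q]
  have "chord D r p q \<subseteq> cball c r" "chord D r q p \<subseteq> cball c r"
    unfolding chord_def by (intro closed_segment_subset convex_cball; use P Q in blast)+
  then show "\<Union>(new_arcs D c) \<subseteq> cball c r" unfolding na by blast
  show "dimage D \<inter> cball c r - ball c r \<subseteq> \<Union>(new_arcs D c)"
  proof
    fix z assume z: "z \<in> dimage D \<inter> cball c r - ball c r"
    then have "z \<in> strand D r p \<or> z \<in> strand D r q" using disc_strands[OF c] pq by auto
    then have "z \<in> chord D r p q \<union> chord D r q p"
      using P(5)[of z] Q(5)[of z] z unfolding chord_def by auto
    then show "z \<in> \<Union>(new_arcs D c)" unfolding na by blast
  qed
qed

lemma crossing_in_dimage:
  assumes "c \<in> crossings D"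
  shows "c \<in> dimage D"
proof -
  obtain p q where "passes D c = {p, q}" "p \<noteq> q" using passes_crossing[OF assms] .
  then show ?thesis using chord_ends(3,4)[OF assms, of p] by blast
qed

lemma compact_smoothing:
  assumes X: "X \<subseteq> crossings D"
  shows "compact (smoothing D X)"
proof -
  have "finite X" using X finite_crossings finite_subset by blast
  moreover have "compact (\<Union>(new_arcs D c))" if "c \<in> X" for c
    using new_arcs(1,4)[of c] that X by (intro compact_Union) auto
  ultimately show ?thesis unfolding smoothing_def
    by (intro compact_Un compact_diff compact_dimage open_UN compact_UN) auto
qed

section \<open>Crossings and the Seifert circles at their ends\<close>

lemma Seifert_graph_simps [simp]:
  "verts (Seifert_graph D) = Seifert_circles D"
  "edges (Seifert_graph D) = crossings D"
  "ends (Seifert_graph D) c = {C \<in> Seifert_circles D. \<exists>a \<in> new_arcs D c. a \<subseteq> C}"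
  by (simp_all add: Seifert_graph_def)

lemma arc_in_circle:
  assumes c: "c \<in> crossings D" and a: "a \<in> new_arcs D c"
  shows "\<exists>!C. C \<in> Seifert_circles D \<and> a \<subseteq> C"
proof -
  have sub: "a \<subseteq> smoothing D (crossings D)" using c a unfolding smoothing_def by blast
  have con: "connected a" "a \<noteq> {}" using new_arcs(4)[OF c a] by auto
  then have "smoothing D (crossings D) \<noteq> {}" using sub by blast
  then obtain C where C: "C \<in> Seifert_circles D" "a \<subseteq> C"
    using exists_component_superset[OF sub _ con(1)] unfolding Seifert_circles_def by blast
  show ?thesis
  proof (rule ex1I[of _ C])
    fix C' assume "C' \<in> Seifert_circles D \<and> a \<subseteq> C'"
    then show "C' = C" using C con components_nonoverlap[of C' _ C] unfolding Seifert_circles_def by blast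
  qed (use C in blast)
qed

lemma ends_Seifert_graph:
  assumes c: "c \<in> crossings D"
  shows "ends (Seifert_graph D) c \<noteq> {}" "card (ends (Seifert_graph D) c) \<le> 2"
proof -
  have "\<exists>f. \<forall>a\<in>new_arcs D c. f a \<in> Seifert_circles D \<and> a \<subseteq> f a"
    by (rule bchoice) (use arc_in_circle[OF c] in blast)
  then obtain f where f: "\<And>a. a \<in> new_arcs D c \<Longrightarrow> f a \<in> Seifert_circles D"
    "\<And>a. a \<in> new_arcs D c \<Longrightarrow> a \<subseteq> f a" by blast
  have "C = f a" if "a \<in> new_arcs D c" "C \<in> Seifert_circles D" "a \<subseteq> C" for a C
    using arc_in_circle[OF c that(1)] f[OF that(1)] that by blast
  then have e: "ends (Seifert_graph D) c = f ` new_arcs D c"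
    unfolding Seifert_graph_simps using f by blast
  show "ends (Seifert_graph D) c \<noteq> {}" unfolding e using new_arcs(2)[OF c] by blast
  show "card (ends (Seifert_graph D) c) \<le> 2"
    unfolding e using card_image_le[OF new_arcs(1)[OF c], of f] new_arcs(3)[OF c] by linarith
qed

text \<open>
  Each of the two groups of circles is completed by the discs of its own crossings outside \<open>X\<close>,
  where the diagram is put back.
\<close>
lemma smoothing_disconnected:
  assumes fin: "finite (Seifert_circles D)" and X: "X \<subseteq> crossings D"
    and A: "A \<subseteq> Seifert_circles D" "A \<noteq> {}" "A \<noteq> Seifert_circles D"
    and sep: "\<And>c. c \<in> crossings D - X \<Longrightarrow> ends (Seifert_graph D) c \<subseteq> A \<or> ends (Seifert_graph D) c \<inter> A = {}"
  shows "\<not> connected (smoothing D X)"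
proof
  assume con: "connected (smoothing D X)"
  let ?T = "smoothing D (crossings D)"
  \<comment> \<open>\<open>K\<close> is a part of the full smoothing that is also present in the
    smoothing at \<open>X\<close>.\<close>
  define K where "K = (dimage D - (\<Union>c\<in>crossings D. ball c r)) \<union> (\<Union>c\<in>X. \<Union>(new_arcs D c))"
  define P where "P = (\<lambda>B. (\<Union>B \<inter> K) \<union>
    (\<Union>c\<in>{c \<in> crossings D - X. ends (Seifert_graph D) c \<subseteq> B}. dimage D \<inter> cball c r))"
  let ?B = "Seifert_circles D - A"
  have fX: "finite X" using X finite_crossings finite_subset by blast
  have T: "?T = \<Union>(Seifert_circles D)" unfolding Seifert_circles_def by (simp add: Union_components)
  have KT: "K \<subseteq> ?T" using X unfolding K_def smoothing_def by blast
  have clT: "closed C" if "C \<in> Seifert_circles D" for C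
    using that closed_components[OF compact_imp_closed[OF compact_smoothing[OF order_refl]]]
    unfolding Seifert_circles_def by blast
  have arcs_compact: "compact (\<Union>(new_arcs D c))" if "c \<in> X" for c
    using new_arcs(1,4)[of c] that X by (intro compact_Union) auto
  have clK: "closed K" unfolding K_def
    using fX arcs_compact by (intro compact_imp_closed compact_Un compact_diff compact_dimage open_UN compact_UN) auto
  have clP: "closed (P B)" if B: "B \<subseteq> Seifert_circles D" for B
  proof -
    have "closed (\<Union>B)" using B fin finite_subset clT by (intro closed_Union) auto
    moreover have "closed (\<Union>c\<in>{c \<in> crossings D - X. ends (Seifert_graph D) c \<subseteq> B}. dimage D \<inter> cball c r)"
      using finite_crossings compact_imp_closed[OF compact_dimage] by (intro closed_UN) auto
    ultimately show ?thesis unfolding P_def using clK by blast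
  qed
  have cover: "smoothing D X \<subseteq> P A \<union> P ?B"
  proof
    fix z assume z: "z \<in> smoothing D X"
    show "z \<in> P A \<union> P ?B"
    proof (cases "z \<in> K")
      case True
      then obtain C where "C \<in> Seifert_circles D" "z \<in> C" using KT T by blast
      then show ?thesis using True unfolding P_def by blast
    next
      case False
      then have "z \<in> dimage D" "z \<notin> (\<Union>c\<in>X. ball c r)" using z unfolding smoothing_def K_def by blast+
      then obtain c where c: "c \<in> crossings D - X" "z \<in> ball c r" using False unfolding K_def by blast
      have "ends (Seifert_graph D) c \<subseteq> Seifert_circles D" by auto
      then have "ends (Seifert_graph D) c \<subseteq> A \<or> ends (Seifert_graph D) c \<subseteq> ?B" using sep[OF c(1)] by blast
      moreover have "z \<in> dimage D \<inter> cball c r" using c \<open>z \<in> dimage D\<close> by auto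
      ultimately show ?thesis using c(1) unfolding P_def by blast
    qed
  qed
  have meet: "P B \<inter> smoothing D X \<noteq> {}"
    if B: "B \<subseteq> Seifert_circles D" "B \<noteq> {}"
      and sepB: "\<And>c. c \<in> crossings D - X \<Longrightarrow> ends (Seifert_graph D) c \<inter> B \<noteq> {} \<Longrightarrow> ends (Seifert_graph D) c \<subseteq> B" for B
  proof -
    obtain C where C: "C \<in> B" using B by blast
    then have CS: "C \<in> components ?T" using B unfolding Seifert_circles_def by blast
    then obtain z where z: "z \<in> C" using in_components_nonempty by blast
    have "z \<in> ?T" using CS z in_components_subset by blast
    then consider "z \<in> dimage D - (\<Union>c\<in>crossings D. ball c r)" | c a where "c \<in> crossings D" "a \<in> new_arcs D c" "z \<in> a"
      unfolding smoothing_def by blast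
    then show ?thesis
    proof cases
      case 1
      then have "z \<in> P B" using z C unfolding P_def K_def by blast
      moreover have "z \<in> smoothing D X" using 1 X unfolding smoothing_def by blast
      ultimately show ?thesis by blast
    next
      case (2 c a)
      show ?thesis
      proof (cases "c \<in> X")
        case True
        then have "z \<in> P B" using z C 2 unfolding P_def K_def by blast
        moreover have "z \<in> smoothing D X" using 2 True unfolding smoothing_def by blast
        ultimately show ?thesis by blast
      next
        case False
        \<comment> \<open>The chord through \<open>z\<close> is undone in the smoothing at
          \<open>X\<close>, so \<open>z\<close> may be lost; the crossing \<open>c\<close>, a point
          of the restored diagram, takes its place.\<close>
        have "a \<subseteq> ?T" using 2 unfolding smoothing_def by blast
        then have "a \<subseteq> C"
          using components_maximal[OF CS _ _] new_arcs(4)[OF 2(1,2)] z 2(3) by blast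
        then have "C \<in> ends (Seifert_graph D) c" using 2 C B by auto
        then have "ends (Seifert_graph D) c \<subseteq> B" using sepB[of c] False 2 C by blast
        then have "c \<in> P B" using False 2 crossing_in_dimage[OF 2(1)] radius_pos unfolding P_def by auto
        moreover have "c \<in> smoothing D X"
        proof -
          have "c \<notin> ball c' r" if "c' \<in> X" for c'
          proof
            assume "c \<in> ball c' r"
            then have "c \<in> cball c r \<inter> cball c' r" using radius_pos by auto
            moreover have "c' \<in> crossings D" "c \<noteq> c'" using that X False by auto
            ultimately show False using balls_disjoint[OF 2(1)] by blast
          qed
          then show ?thesis using crossing_in_dimage[OF 2(1)] unfolding smoothing_def by blast
        qed
        ultimately show ?thesis by blast
      qed
    qed
  qed
  \<comment> \<open>The discs are closed to make \<open>P\<close> closed, so \<open>K\<close> may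
    touch them on their circles. There it lies on a new arc of \<open>c\<close>, hence in a Seifert
    circle belonging to \<open>B\<close>.\<close>
  have half: "z \<notin> \<Union>B' \<inter> K" if c: "c \<in> crossings D - X" "ends (Seifert_graph D) c \<subseteq> B" "z \<in> dimage D \<inter> cball c r"
    and B: "B \<subseteq> Seifert_circles D" "B' \<subseteq> Seifert_circles D" "B \<inter> B' = {}" for B B' c z
  proof
    assume z: "z \<in> \<Union>B' \<inter> K"
    have cC: "c \<in> crossings D" using c by blast
    have "z \<notin> (\<Union>c\<in>X. \<Union>(new_arcs D c))"
    proof
      assume "z \<in> (\<Union>c\<in>X. \<Union>(new_arcs D c))"
      then obtain c' where "c' \<in> X" "z \<in> cball c' r" using new_arcs(5) X by blast
      then show False using balls_disjoint[of c c'] c X by blast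
    qed
    then have "z \<notin> ball c r" using z cC unfolding K_def by blast
    then obtain a where a: "a \<in> new_arcs D c" "z \<in> a" using new_arcs(6)[OF cC] c(3) by blast
    obtain C where C: "C \<in> Seifert_circles D" "a \<subseteq> C" using arc_in_circle[OF cC a(1)] by blast
    then have "C \<in> ends (Seifert_graph D) c" using a by auto
    then have "C \<in> B" using c by blast
    obtain C' where C': "C' \<in> B'" "z \<in> C'" using z by blast
    have "C \<noteq> C'" using \<open>C \<in> B\<close> C' B by blast
    then show False using components_nonoverlap[of C ?T C'] C C' B a unfolding Seifert_circles_def by blast
  qed
  have "P A \<inter> P ?B = {}"
  proof (rule equals0I)
    fix z assume z: "z \<in> P A \<inter> P ?B"
    have B: "?B \<subseteq> Seifert_circles D" "A \<inter> ?B = {}" "?B \<inter> A = {}" by auto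
    consider (KK) "z \<in> \<Union>A \<inter> K" "z \<in> \<Union>?B \<inter> K"
      | (ZK) c where "c \<in> crossings D - X" "ends (Seifert_graph D) c \<subseteq> A" "z \<in> dimage D \<inter> cball c r" "z \<in> \<Union>?B \<inter> K"
      | (KZ) c where "c \<in> crossings D - X" "ends (Seifert_graph D) c \<subseteq> ?B" "z \<in> dimage D \<inter> cball c r" "z \<in> \<Union>A \<inter> K"
      | (ZZ) c c' where "c \<in> crossings D" "ends (Seifert_graph D) c \<subseteq> A" "z \<in> cball c r"
          "c' \<in> crossings D" "ends (Seifert_graph D) c' \<subseteq> ?B" "z \<in> cball c' r"
      using z unfolding P_def by blast
    then show False
    proof cases
      case KK
      then obtain C C' where "C \<in> A" "z \<in> C" "C' \<in> ?B" "z \<in> C'" by blast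
      then show False using components_nonoverlap[of C ?T C'] A unfolding Seifert_circles_def by blast
    next
      case ZK
      then show False using half[OF ZK(1-3) A(1) B(1,2)] by blast
    next
      case KZ
      then show False using half[OF KZ(1-3) B(1) A(1) B(3)] by blast
    next
      case (ZZ c c')
      have "c \<noteq> c'" using ZZ ends_Seifert_graph(1)[OF ZZ(1)] by blast
      then show False using balls_disjoint[OF ZZ(1,4)] ZZ(3,6) by blast
    qed
  qed
  moreover have "P A \<inter> smoothing D X \<noteq> {}" by (rule meet) (use A sep in blast)+
  moreover have "P ?B \<inter> smoothing D X \<noteq> {}"
  proof (rule meet)
    show "?B \<noteq> {}" using A by blast
    fix c assume c: "c \<in> crossings D - X" "ends (Seifert_graph D) c \<inter> ?B \<noteq> {}"
    have "ends (Seifert_graph D) c \<subseteq> Seifert_circles D" by auto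
    then show "ends (Seifert_graph D) c \<subseteq> ?B" using sep[OF c(1)] c(2) by blast
  qed auto
  ultimately show False
    using connected_closedD[OF con _ cover clP clP] A(1) by blast
qed

text \<open>
  As \<^const>\<open>card\<close> is 0 on infinite sets, it has to be shown that the smoothing has finitely many
  components. By the Sura-Bura theorem, a component that misses both new arcs lies in a clopen
  part that misses them, and this part would split the connected diagram.
\<close>
lemma disconnected_nugatory:
  assumes con: "connected (dimage D)" and c: "c \<in> crossings D" and dis: "\<not> connected (smoothing D {c})"
  shows "nugatory D c"
proof -
  let ?T = "smoothing D {c}" and ?arcs = "\<Union>(new_arcs D c)"
  have T: "?T = (dimage D - ball c r) \<union> ?arcs" by (simp add: smoothing_def)
  have compT: "compact ?T" using compact_smoothing[of "{c}"] c by simp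
  have meets: "Q \<inter> ?arcs \<noteq> {}" if Q: "Q \<in> components ?T" for Q
  proof
    assume dj: "Q \<inter> ?arcs = {}"
    have carcs: "closed ?arcs"
      using new_arcs(1,4)[OF c] by (intro closed_Union) (auto intro: compact_imp_closed)
    obtain N where N: "openin (top_of_set ?T) N" "compact N" "Q \<subseteq> N" "N \<subseteq> - ?arcs"
    proof (rule Sura_Bura_clopen_subset[of ?T Q "- ?arcs"])
      show "locally compact ?T" by (rule closed_imp_locally_compact[OF compact_imp_closed[OF compT]])
      show "compact Q" using compact_components[OF compT Q] .
    qed (use Q carcs dj in auto)
    have NT: "N \<subseteq> ?T" using N(1) openin_imp_subset by blast
    have "closedin (top_of_set ?T) (?T - N)" using N(1) by (simp add: closedin_diff)
    then have "closed (?T - N)" using closedin_closed_eq[OF compact_imp_closed[OF compT]] by blast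
    then have clM: "closed ((?T - N) \<inter> dimage D \<union> dimage D \<inter> cball c r)"
      using compact_imp_closed[OF compact_dimage] by (intro closed_Un closed_Int) auto
    \<comment> \<open>Within the closed disc, all points of \<open>?T\<close> lie on new
      arcs.\<close>
    have "N \<inter> cball c r = {}"
      using NT N(4) new_arcs(6)[OF c] unfolding T by blast
    then have e: "N \<inter> ((?T - N) \<inter> dimage D \<union> dimage D \<inter> cball c r) \<inter> dimage D = {}" by blast
    have "dimage D \<subseteq> N \<union> ((?T - N) \<inter> dimage D \<union> dimage D \<inter> cball c r)" unfolding T by auto
    from connected_closedD[OF con e this compact_imp_closed[OF N(2)] clM]
    have "N \<inter> dimage D = {} \<or> c \<notin> dimage D" using radius_pos by auto
    moreover have "N \<subseteq> dimage D" using NT N(4) unfolding T by blast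
    moreover have "N \<noteq> {}" using in_components_nonempty[OF Q] N(3) by blast
    ultimately show False using crossing_in_dimage[OF c] by blast
  qed
  \<comment> \<open>A component contains every arc that it meets, so one point chosen on that arc
    determines it.\<close>
  have "components ?T \<subseteq> (\<lambda>a. connected_component_set ?T (SOME x. x \<in> a)) ` new_arcs D c"
  proof
    fix Q assume Q: "Q \<in> components ?T"
    then obtain a where a: "a \<in> new_arcs D c" "Q \<inter> a \<noteq> {}" using meets by blast
    have "a \<subseteq> ?T" using a(1) unfolding T by blast
    then have "a \<subseteq> Q" using components_maximal[OF Q _ _ a(2)] new_arcs(4)[OF c a(1)] by blast
    moreover have "(SOME x. x \<in> a) \<in> a" using new_arcs(4)[OF c a(1)] by (simp add: some_in_eq)
    ultimately have x: "(SOME x. x \<in> a) \<in> Q" by blast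
    obtain y where y: "Q = connected_component_set ?T y" using Q by (auto simp: components_iff)
    have "Q = connected_component_set ?T (SOME x. x \<in> a)"
      using connected_component_eq[OF x[unfolded y]] y by simp
    then show "Q \<in> (\<lambda>a. connected_component_set ?T (SOME x. x \<in> a)) ` new_arcs D c" using a(1) by blast
  qed
  then have fin: "finite (components ?T)" using new_arcs(1)[OF c] finite_surj by blast
  have "?T \<noteq> {}" using new_arcs(2,4)[OF c] unfolding T by blast
  then have "card (components ?T) \<noteq> 0" using fin by (simp add: components_eq_empty)
  moreover have "card (components ?T) \<noteq> 1"
    using dis components_eq_sing_exists[of ?T] by (metis card_1_singletonE)
  moreover have "components (dimage D) = {dimage D}"
    using con crossing_in_dimage[OF c] by (auto simp: components_eq_sing_iff)
  ultimately show ?thesis using c unfolding nugatory_def by simp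
qed

end

section \<open>The inequality\<close>

theorem theorem17:
  fixes D :: "'t diagram"
  assumes "generic_immersion D"
    and "connected (dimage D)"
    and "\<forall>c \<in> crossings D. \<not> nugatory D c"
  shows "int (tc D) \<ge> 2 * (int (Seifert_number D) - int (diagram_index D) - 1)"
proof (cases "finite (Seifert_circles D)")
  case True
  interpret generic_diagram D by unfold_locales (rule assms(1))
  let ?G = "Seifert_graph D"
  have "2 * card (verts ?G) \<le> card (edges ?G) + 2 * graph_index ?G + 2"
  proof (rule edges_ge_index)
    show "finite (verts ?G)" using True by simp
    show "finite (edges ?G)" using finite_crossings by simp
    show "ends ?G c \<subseteq> verts ?G \<and> card (ends ?G c) \<le> 2" if "c \<in> edges ?G" for c
      using that ends_Seifert_graph(2)[of c] by auto
  next
    fix A assume A: "A \<subseteq> verts ?G" "A \<noteq> {}" "A \<noteq> verts ?G"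
    define X where "X = {c \<in> edges ?G. ends ?G c \<inter> A \<noteq> {} \<and> ends ?G c - A \<noteq> {}}"
    have X: "X \<subseteq> crossings D" unfolding X_def by auto
    have dis: "\<not> connected (smoothing D X)"
    proof (rule smoothing_disconnected[OF True X _ A(2)])
      show "A \<subseteq> Seifert_circles D" "A \<noteq> Seifert_circles D" using A by simp_all
      fix c assume "c \<in> crossings D - X"
      then have "c \<in> edges ?G" "c \<notin> X" by simp_all
      then show "ends ?G c \<subseteq> A \<or> ends ?G c \<inter> A = {}" unfolding X_def by blast
    qed
    have "card X \<noteq> 0"
    proof
      assume "card X = 0"
      then have "X = {}" using finite_subset[OF X finite_crossings] by simp
      \<comment> \<open>Smoothing at no crossing leaves the connected diagram itself.\<close>
      then show False using dis assms(2) by (simp add: smoothing_def)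
    qed
    moreover have "card X \<noteq> 1"
    proof
      assume "card X = 1"
      then obtain c where c: "X = {c}" by (auto simp: card_1_singleton_iff)
      then show False using disconnected_nugatory[OF assms(2), of c] dis X assms(3) by auto
    qed
    ultimately show "card {c \<in> edges ?G. ends ?G c \<inter> A \<noteq> {} \<and> ends ?G c - A \<noteq> {}} \<ge> 2"
      unfolding X_def by linarith
  qed
  then show ?thesis by (simp add: tc_def Seifert_number_def diagram_index_def)
qed (simp add: Seifert_number_def) \<comment> \<open>otherwise \<^const>\<open>Seifert_number\<close> is the junk value 0\<close>

end
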